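(* Let $\mathcal{C}$ be a $\mathcal{V}\text{-}\mathsf{Cat}_{\mathsf{sep}}$-enriched autonomous category. Then the linear $\mathcal{V}\lambda$-theory $\mathrm{Lang}(\mathcal{C})$ is varietal.
   Context: Standing assumptions on $\mathcal{V}$: commutative unital quantale (complete lattice, commutative associative $\otimes$ distributing over joins, unit $k$), integral ($k=\top$), with continuous underlying lattice and a fixed basis $B$ closed under finite joins and $\otimes$ and containing $k$. $\mathcal{V}$-categories $(X,a)$: $a:X\times X\to\mathcal{V}$, $k\le a(x,x)$, $a(x,y)\otimes a(y,z)\le a(x,z)$; separated if $k\le a(x,y)$ and $k\le a(y,x)$ imply $x=y$. A $\mathcal{V}\text{-}\mathsf{Cat}_{\mathsf{sep}}$-enriched autonomous category is a symmetric monoidal closed (autonomous) category whose hom-sets are small separated $\mathcal{V}$-categories such that composition and the action of $\otimes$ on homs are $\mathcal{V}$-functors (w.r.t. the pointwise tensor $(a\otimes b)((x,y),(x',y'))=a(x,x')\otimes b(y,y')$), and $-\otimes X\dashv X\multimap -$ is an enriched adjunction. Linear $\mathcal{V}\lambda$-theories: over ground types $G$ and operation symbols $\Sigma$ (each $f:A_1,\dots,A_n\to A$, $n\ge1$) one forms linear $\lambda$-terms (types $X\in G$, $I$, $A\otimes B$, $A\multimap B$; terms $f(\vec v)$, variables, $\ast$, $v\ \mathtt{to}\ \ast.\,w$, $v\otimes w$, $\mathtt{pm}\ v\ \mathtt{to}\ x\otimes y.\,w$, $\lambda x.\,v$, $v\,w$, linearly typed); a theory has axioms $Ax$ which are $\mathcal{V}$-equations-in-context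 $\Gamma\rhd v=_q w:A$ with $q\in B$; its theorems are those derivable from $Ax$ and the $\beta\eta$/commuting-conversion equations of linear $\lambda$-calculus by the $\mathcal{V}$-congruence rules (reflexivity with label $\top$, transitivity with label $q\otimes r$, weakening of labels, Archimedean rule, finite joins, compatibility with term constructors and substitution, context permutation). For types $A,B$, the terms $v$ with $x:A\rhd v:B$ form a $\mathcal{V}$-category with $a(v,w)=\bigvee\{q\mid x:A\rhd v=_q w:B$ is a theorem$\}$; its separated quotient (identify $v,w$ when $a(v,w)\ge k$ and $a(w,v)\ge k$) is denoted $\mathcal{C}_T(A,B)$. The theory is varietal if every $\mathcal{C}_T(A,B)$ is small (a set). $\mathrm{Lang}(\mathcal{C})$: ground types are the objects of $\mathcal{C}$; operation symbols are all morphisms of $\mathcal{C}$ together with, for each type $A$, isomorphisms between $A$ and $i(A)$, where $i(I)=\hat I$, $i(X)=X$, $i(A\otimes B)=i(A)\,\hat\otimes\, i(B)$, $i(A\multimap B)=i(A)\,\hat\multimap\, i(B)$ (hats denoting the monoidal closed structure of $\mathcal{C}$); axioms are all $\mathcal{V}$-equations-in-context satisfied by the obvious interpretation in $\mathcal{C}$ (i.e. those with $a(\llbracket v\rrbracket,\llbracket w\rrbracket)\ge q$ in the hom-$\mathcal{V}$-category). *)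

theory Defs
  imports Main "HOL-Library.FuncSet" "HOL-Library.Multiset"
begin

unbundle cardinal_syntax

section \<open>Quantales\<close>

class integral_quantale = complete_lattice + comm_monoid_mult +
  assumes mult_Sup: "x * Sup S = Sup ((\<lambda>y. x * y) ` S)"
    and one_eq_top: "1 = top"

definition way_below :: "'v::complete_lattice \<Rightarrow> 'v \<Rightarrow> bool" (infix "\<lless>" 50) where
  "y \<lless> x \<longleftrightarrow> (\<forall>S. x \<le> Sup S \<longrightarrow> (\<exists>F. finite F \<and> F \<subseteq> S \<and> y \<le> Sup F))"

definition directed :: "'v::order set \<Rightarrow> bool" where
  "directed D \<longleftrightarrow> D \<noteq> {} \<and> (\<forall>x\<in>D. \<forall>y\<in>D. \<exists>z\<in>D. x \<le> z \<and> y \<le> z)"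

text \<open>Finite joins include the empty one, so \<open>bot \<in> B\<close>.\<close>

locale continuous_quantale_basis =
  fixes B :: "'v::integral_quantale set"
  assumes continuous: "x = Sup {y. y \<lless> (x::'v)}"
    and basis_directed: "directed {b \<in> B. b \<lless> x}"
    and basis_Sup: "x = Sup {b \<in> B. b \<lless> x}"
    and finite_join_closed: "finite F \<Longrightarrow> F \<subseteq> B \<Longrightarrow> Sup F \<in> B"
    and mult_closed: "p \<in> B \<Longrightarrow> q \<in> B \<Longrightarrow> p * q \<in> B"
    and one_closed: "1 \<in> B"

section \<open>Categories over a quantale\<close>

definition vcat :: "'a set \<Rightarrow> ('a \<Rightarrow> 'a \<Rightarrow> 'v::integral_quantale) \<Rightarrow> bool" where
  "vcat X a \<longleftrightarrow> (\<forall>x\<in>X. 1 \<le> a x x) \<and> (\<forall>x\<in>X. \<forall>y\<in>X. \<forall>z\<in>X. a x y * a y z \<le> a x z)"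

definition separated :: "'a set \<Rightarrow> ('a \<Rightarrow> 'a \<Rightarrow> 'v::integral_quantale) \<Rightarrow> bool" where
  "separated X a \<longleftrightarrow> (\<forall>x\<in>X. \<forall>y\<in>X. 1 \<le> a x y \<and> 1 \<le> a y x \<longrightarrow> x = y)"

definition vfunctor :: "'a set \<Rightarrow> ('a \<Rightarrow> 'a \<Rightarrow> 'v::integral_quantale) \<Rightarrow>
    'b set \<Rightarrow> ('b \<Rightarrow> 'b \<Rightarrow> 'v) \<Rightarrow> ('a \<Rightarrow> 'b) \<Rightarrow> bool" where
  "vfunctor X a Y b F \<longleftrightarrow> F \<in> X \<rightarrow> Y \<and> (\<forall>x\<in>X. \<forall>y\<in>X. a x y \<le> b (F x) (F y))"

definition vtensor :: "('a \<Rightarrow> 'a \<Rightarrow> 'v::integral_quantale) \<Rightarrow> ('b \<Rightarrow> 'b \<Rightarrow> 'v) \<Rightarrow>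
    'a \<times> 'b \<Rightarrow> 'a \<times> 'b \<Rightarrow> 'v" where
  "vtensor a b = (\<lambda>(x, y) (x', y'). a x x' * b y y')"

text \<open>
  Smallness is relative to a cardinal \<open>\<kappa>\<close>: a set is small when it has fewer than \<open>\<kappa>\<close> elements.
  For a strongly inaccessible \<open>\<kappa>\<close> this is smallness in the corresponding Grothendieck universe.
\<close>

definition small :: "'k rel \<Rightarrow> 'a set \<Rightarrow> bool" where
  "small \<kappa> X \<longleftrightarrow> |X| <o \<kappa>"

section \<open>Enriched autonomous categories\<close>

text \<open>
  \<open>g \<cdot> f\<close> is \<open>g\<close> after \<open>f\<close>; \<open>\<boxtimes>\<close> is the action of the tensor on arrows, \<open>lolli_arr C X g\<close> the
  action of \<open>X \<multimap> -\<close> on the arrow \<open>g\<close>, and \<open>curry_arr C Z X Y\<close> the bijection from arrows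
  \<open>Z \<otimes> X \<rightarrow> Y\<close> to arrows \<open>Z \<rightarrow> X \<multimap> Y\<close>. The function \<open>dist\<close> is only meaningful on parallel arrows.
\<close>

record ('o, 'm, 'v) autcat =
  Obj :: "'o set"
  Arr :: "'m set"
  Dom :: "'m \<Rightarrow> 'o"
  Cod :: "'m \<Rightarrow> 'o"
  id_arr :: "'o \<Rightarrow> 'm"
  Comp :: "'m \<Rightarrow> 'm \<Rightarrow> 'm" (infixr "\<cdot>\<index>" 65)
  tensor_obj :: "'o \<Rightarrow> 'o \<Rightarrow> 'o" (infixl "\<otimes>\<index>" 70)
  tensor_arr :: "'m \<Rightarrow> 'm \<Rightarrow> 'm" (infixl "\<boxtimes>\<index>" 70)
  unit_obj :: "'o" ("\<I>\<index>")
  assoc :: "'o \<Rightarrow> 'o \<Rightarrow> 'o \<Rightarrow> 'm"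
  lunit :: "'o \<Rightarrow> 'm"
  runit :: "'o \<Rightarrow> 'm"
  braid :: "'o \<Rightarrow> 'o \<Rightarrow> 'm"
  lolli_obj :: "'o \<Rightarrow> 'o \<Rightarrow> 'o" (infixr "\<multimap>\<index>" 68)
  lolli_arr :: "'o \<Rightarrow> 'm \<Rightarrow> 'm"
  curry_arr :: "'o \<Rightarrow> 'o \<Rightarrow> 'o \<Rightarrow> 'm \<Rightarrow> 'm"
  dist :: "'m \<Rightarrow> 'm \<Rightarrow> 'v"

definition hom :: "('o, 'm, 'v, 'z) autcat_scheme \<Rightarrow> 'o \<Rightarrow> 'o \<Rightarrow> 'm set" where
  "hom C X Y = {f \<in> Arr C. Dom C f = X \<and> Cod C f = Y}"

definition is_inverse :: "('o, 'm, 'v, 'z) autcat_scheme \<Rightarrow> 'm \<Rightarrow> 'm \<Rightarrow> bool" where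
  "is_inverse C f g \<longleftrightarrow> g \<in> hom C (Cod C f) (Dom C f) \<and>
     g \<cdot>\<^bsub>C\<^esub> f = id_arr C (Dom C f) \<and> f \<cdot>\<^bsub>C\<^esub> g = id_arr C (Cod C f)"

definition iso_arrs :: "('o, 'm, 'v, 'z) autcat_scheme \<Rightarrow> 'o \<Rightarrow> 'o \<Rightarrow> 'm set" where
  "iso_arrs C X Y = {f \<in> hom C X Y. \<exists>g. is_inverse C f g}"

definition inv_arr :: "('o, 'm, 'v, 'z) autcat_scheme \<Rightarrow> 'm \<Rightarrow> 'm" where
  "inv_arr C f = (THE g. is_inverse C f g)"

definition eval_arr :: "('o, 'm, 'v, 'z) autcat_scheme \<Rightarrow> 'o \<Rightarrow> 'o \<Rightarrow> 'm" where
  "eval_arr C X Y =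
     inv_into (hom C ((X \<multimap>\<^bsub>C\<^esub> Y) \<otimes>\<^bsub>C\<^esub> X) Y) (curry_arr C (X \<multimap>\<^bsub>C\<^esub> Y) X Y) (id_arr C (X \<multimap>\<^bsub>C\<^esub> Y))"

locale category =
  fixes C :: "('o, 'm, 'v) autcat" (structure)
  assumes Dom_Obj: "f \<in> Arr C \<Longrightarrow> Dom C f \<in> Obj C"
    and Cod_Obj: "f \<in> Arr C \<Longrightarrow> Cod C f \<in> Obj C"
    and Id_hom: "X \<in> Obj C \<Longrightarrow> id_arr C X \<in> hom C X X"
    and Comp_hom: "f \<in> hom C X Y \<Longrightarrow> g \<in> hom C Y Z \<Longrightarrow> g \<cdot> f \<in> hom C X Z"
    and Comp_Id: "f \<in> hom C X Y \<Longrightarrow> f \<cdot> id_arr C X = f"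
    and Id_Comp: "f \<in> hom C X Y \<Longrightarrow> id_arr C Y \<cdot> f = f"
    and Comp_assoc: "f \<in> hom C W X \<Longrightarrow> g \<in> hom C X Y \<Longrightarrow> h \<in> hom C Y Z \<Longrightarrow>
      (h \<cdot> g) \<cdot> f = h \<cdot> (g \<cdot> f)"

locale symmetric_monoidal_category = category +
  assumes unit_Obj: "\<I> \<in> Obj C"
    and tensor_Obj: "X \<in> Obj C \<Longrightarrow> Y \<in> Obj C \<Longrightarrow> X \<otimes> Y \<in> Obj C"
    and tensor_hom: "f \<in> hom C X Y \<Longrightarrow> g \<in> hom C X' Y' \<Longrightarrow> f \<boxtimes> g \<in> hom C (X \<otimes> X') (Y \<otimes> Y')"
    and tensor_Id: "X \<in> Obj C \<Longrightarrow> Y \<in> Obj C \<Longrightarrow> id_arr C X \<boxtimes> id_arr C Y = id_arr C (X \<otimes> Y)"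
    and tensor_Comp: "f \<in> hom C X Y \<Longrightarrow> g \<in> hom C Y Z \<Longrightarrow> f' \<in> hom C X' Y' \<Longrightarrow> g' \<in> hom C Y' Z' \<Longrightarrow>
      (g \<cdot> f) \<boxtimes> (g' \<cdot> f') = (g \<boxtimes> g') \<cdot> (f \<boxtimes> f')"
    and assoc_iso: "X \<in> Obj C \<Longrightarrow> Y \<in> Obj C \<Longrightarrow> Z \<in> Obj C \<Longrightarrow>
      assoc C X Y Z \<in> iso_arrs C ((X \<otimes> Y) \<otimes> Z) (X \<otimes> (Y \<otimes> Z))"
    and assoc_natural: "f \<in> hom C X X' \<Longrightarrow> g \<in> hom C Y Y' \<Longrightarrow> h \<in> hom C Z Z' \<Longrightarrow>
      assoc C X' Y' Z' \<cdot> ((f \<boxtimes> g) \<boxtimes> h) = (f \<boxtimes> (g \<boxtimes> h)) \<cdot> assoc C X Y Z"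
    and lunit_iso: "X \<in> Obj C \<Longrightarrow> lunit C X \<in> iso_arrs C (\<I> \<otimes> X) X"
    and lunit_natural: "f \<in> hom C X Y \<Longrightarrow> lunit C Y \<cdot> (id_arr C \<I> \<boxtimes> f) = f \<cdot> lunit C X"
    and runit_iso: "X \<in> Obj C \<Longrightarrow> runit C X \<in> iso_arrs C (X \<otimes> \<I>) X"
    and runit_natural: "f \<in> hom C X Y \<Longrightarrow> runit C Y \<cdot> (f \<boxtimes> id_arr C \<I>) = f \<cdot> runit C X"
    and braid_iso: "X \<in> Obj C \<Longrightarrow> Y \<in> Obj C \<Longrightarrow> braid C X Y \<in> iso_arrs C (X \<otimes> Y) (Y \<otimes> X)"
    and braid_natural: "f \<in> hom C X X' \<Longrightarrow> g \<in> hom C Y Y' \<Longrightarrow>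
      braid C X' Y' \<cdot> (f \<boxtimes> g) = (g \<boxtimes> f) \<cdot> braid C X Y"
    and pentagon: "W \<in> Obj C \<Longrightarrow> X \<in> Obj C \<Longrightarrow> Y \<in> Obj C \<Longrightarrow> Z \<in> Obj C \<Longrightarrow>
      assoc C W X (Y \<otimes> Z) \<cdot> assoc C (W \<otimes> X) Y Z =
      (id_arr C W \<boxtimes> assoc C X Y Z) \<cdot> assoc C W (X \<otimes> Y) Z \<cdot> (assoc C W X Y \<boxtimes> id_arr C Z)"
    and triangle: "X \<in> Obj C \<Longrightarrow> Y \<in> Obj C \<Longrightarrow>
      (id_arr C X \<boxtimes> lunit C Y) \<cdot> assoc C X \<I> Y = runit C X \<boxtimes> id_arr C Y"
    and braid_symmetric: "X \<in> Obj C \<Longrightarrow> Y \<in> Obj C \<Longrightarrow> braid C Y X \<cdot> braid C X Y = id_arr C (X \<otimes> Y)"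
    and hexagon: "X \<in> Obj C \<Longrightarrow> Y \<in> Obj C \<Longrightarrow> Z \<in> Obj C \<Longrightarrow>
      assoc C Y Z X \<cdot> braid C X (Y \<otimes> Z) \<cdot> assoc C X Y Z =
      (id_arr C Y \<boxtimes> braid C X Z) \<cdot> assoc C Y X Z \<cdot> (braid C X Y \<boxtimes> id_arr C Z)"

locale autonomous_category = symmetric_monoidal_category +
  assumes lolli_Obj: "X \<in> Obj C \<Longrightarrow> Y \<in> Obj C \<Longrightarrow> X \<multimap> Y \<in> Obj C"
    and lolli_hom: "X \<in> Obj C \<Longrightarrow> g \<in> hom C Y Y' \<Longrightarrow> lolli_arr C X g \<in> hom C (X \<multimap> Y) (X \<multimap> Y')"
    and lolli_Id: "X \<in> Obj C \<Longrightarrow> Y \<in> Obj C \<Longrightarrow> lolli_arr C X (id_arr C Y) = id_arr C (X \<multimap> Y)"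
    and lolli_Comp: "X \<in> Obj C \<Longrightarrow> f \<in> hom C Y Y' \<Longrightarrow> g \<in> hom C Y' Y'' \<Longrightarrow>
      lolli_arr C X (g \<cdot> f) = lolli_arr C X g \<cdot> lolli_arr C X f"
    and curry_bij: "X \<in> Obj C \<Longrightarrow> Y \<in> Obj C \<Longrightarrow> Z \<in> Obj C \<Longrightarrow>
      bij_betw (curry_arr C Z X Y) (hom C (Z \<otimes> X) Y) (hom C Z (X \<multimap> Y))"
    and curry_natural: "X \<in> Obj C \<Longrightarrow> h \<in> hom C Z' Z \<Longrightarrow> f \<in> hom C (Z \<otimes> X) Y \<Longrightarrow> g \<in> hom C Y Y' \<Longrightarrow>
      curry_arr C Z' X Y' (g \<cdot> f \<cdot> (h \<boxtimes> id_arr C X)) = lolli_arr C X g \<cdot> curry_arr C Z X Y f \<cdot> h"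

text \<open>
  Enrichment of the functor \<open>- \<otimes> X\<close> is a special case of \<open>tensor_vfunctor\<close>, and the last assumption
  makes the bijection of the adjunction an isomorphism of \<open>'v\<close>-categories.
\<close>

locale enriched_autonomous_category =
  autonomous_category C for C :: "('o, 'm, 'v::integral_quantale) autcat" (structure) +
  fixes \<kappa> :: "'k rel"
  assumes hom_small: "X \<in> Obj C \<Longrightarrow> Y \<in> Obj C \<Longrightarrow> small \<kappa> (hom C X Y)"
    and hom_vcat: "X \<in> Obj C \<Longrightarrow> Y \<in> Obj C \<Longrightarrow> vcat (hom C X Y) (dist C)"
    and hom_separated: "X \<in> Obj C \<Longrightarrow> Y \<in> Obj C \<Longrightarrow> separated (hom C X Y) (dist C)"
    and Comp_vfunctor: "X \<in> Obj C \<Longrightarrow> Y \<in> Obj C \<Longrightarrow> Z \<in> Obj C \<Longrightarrow>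
      vfunctor (hom C X Y \<times> hom C Y Z) (vtensor (dist C) (dist C)) (hom C X Z) (dist C)
        (\<lambda>(f, g). g \<cdot> f)"
    and tensor_vfunctor: "X \<in> Obj C \<Longrightarrow> Y \<in> Obj C \<Longrightarrow> X' \<in> Obj C \<Longrightarrow> Y' \<in> Obj C \<Longrightarrow>
      vfunctor (hom C X Y \<times> hom C X' Y') (vtensor (dist C) (dist C))
        (hom C (X \<otimes> X') (Y \<otimes> Y')) (dist C) (\<lambda>(f, g). f \<boxtimes> g)"
    and lolli_vfunctor: "X \<in> Obj C \<Longrightarrow> Y \<in> Obj C \<Longrightarrow> Y' \<in> Obj C \<Longrightarrow>
      vfunctor (hom C Y Y') (dist C) (hom C (X \<multimap> Y) (X \<multimap> Y')) (dist C) (lolli_arr C X)"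
    and curry_isometry: "X \<in> Obj C \<Longrightarrow> Y \<in> Obj C \<Longrightarrow> Z \<in> Obj C \<Longrightarrow>
      f \<in> hom C (Z \<otimes> X) Y \<Longrightarrow> g \<in> hom C (Z \<otimes> X) Y \<Longrightarrow>
      dist C (curry_arr C Z X Y f) (curry_arr C Z X Y g) = dist C f g"

section \<open>Linear lambda terms\<close>

datatype 'g ty = Ground 'g | Unit | Tensor "'g ty" "'g ty" | Lolli "'g ty" "'g ty"

type_synonym var = nat

type_synonym 'g ctx = "(var \<times> 'g ty) list"

text \<open>
  Terms up to renaming of bound variables: free variables are named and bound ones are de Bruijn
  indices. \<open>LetStar v w\<close> is \<open>v to *. w\<close>, and \<open>LetPair\<close> binds two variables in its second argument.
  The binders with named variables are \<open>LAM\<close> and \<open>PM\<close> below.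
\<close>

datatype ('g, 'f) trm =
    Var var
  | Bound nat
  | Op 'f "('g, 'f) trm list"
  | Star
  | LetStar "('g, 'f) trm" "('g, 'f) trm"
  | Tens "('g, 'f) trm" "('g, 'f) trm"
  | LetPair "('g, 'f) trm" "('g, 'f) trm"
  | Lam "'g ty" "('g, 'f) trm"
  | App "('g, 'f) trm" "('g, 'f) trm"

primrec bind :: "nat \<Rightarrow> var \<Rightarrow> ('g, 'f) trm \<Rightarrow> ('g, 'f) trm" where
  "bind k x (Var y) = (if y = x then Bound k else Var y)"
| "bind k x (Bound i) = Bound i"
| "bind k x (Op f vs) = Op f (map (bind k x) vs)"
| "bind k x Star = Star"
| "bind k x (LetStar v w) = LetStar (bind k x v) (bind k x w)"
| "bind k x (Tens v w) = Tens (bind k x v) (bind k x w)"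
| "bind k x (LetPair v w) = LetPair (bind k x v) (bind (k + 2) x w)"
| "bind k x (Lam A v) = Lam A (bind (k + 1) x v)"
| "bind k x (App v w) = App (bind k x v) (bind k x w)"

text \<open>\<open>LAM x A v\<close> is \<open>\<lambda>x : A. v\<close>, and \<open>PM v x y w\<close> is \<open>pm v to x \<otimes> y. w\<close>.\<close>

definition LAM :: "var \<Rightarrow> 'g ty \<Rightarrow> ('g, 'f) trm \<Rightarrow> ('g, 'f) trm" where
  "LAM x A v = Lam A (bind 0 x v)"

definition PM :: "('g, 'f) trm \<Rightarrow> var \<Rightarrow> var \<Rightarrow> ('g, 'f) trm \<Rightarrow> ('g, 'f) trm" where
  "PM v x y w = LetPair v (bind 1 x (bind 0 y w))"

text \<open>
  Simultaneous substitution for free variables. It cannot capture as long as the substituted terms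
  have no unbound index, which holds for all typable terms.
\<close>

primrec psubst :: "(var \<Rightarrow> ('g, 'f) trm) \<Rightarrow> ('g, 'f) trm \<Rightarrow> ('g, 'f) trm" where
  "psubst \<sigma> (Var y) = \<sigma> y"
| "psubst \<sigma> (Bound i) = Bound i"
| "psubst \<sigma> (Op f vs) = Op f (map (psubst \<sigma>) vs)"
| "psubst \<sigma> Star = Star"
| "psubst \<sigma> (LetStar v w) = LetStar (psubst \<sigma> v) (psubst \<sigma> w)"
| "psubst \<sigma> (Tens v w) = Tens (psubst \<sigma> v) (psubst \<sigma> w)"
| "psubst \<sigma> (LetPair v w) = LetPair (psubst \<sigma> v) (psubst \<sigma> w)"
| "psubst \<sigma> (Lam A v) = Lam A (psubst \<sigma> v)"
| "psubst \<sigma> (App v w) = App (psubst \<sigma> v) (psubst \<sigma> w)"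

abbreviation subst1 :: "('g, 'f) trm \<Rightarrow> var \<Rightarrow> ('g, 'f) trm \<Rightarrow> ('g, 'f) trm" where
  "subst1 v x w \<equiv> psubst (Var(x := w)) v"

section \<open>Typing\<close>

record ('g, 'f) sig =
  grounds :: "'g set"
  ops :: "'f set"
  args :: "'f \<Rightarrow> 'g ty list"
  res :: "'f \<Rightarrow> 'g ty"

definition wf_ty :: "('g, 'f, 'z) sig_scheme \<Rightarrow> 'g ty \<Rightarrow> bool" where
  "wf_ty S A \<longleftrightarrow> set_ty A \<subseteq> grounds S"

definition wf_sig :: "('g, 'f, 'z) sig_scheme \<Rightarrow> bool" where
  "wf_sig S \<longleftrightarrow> (\<forall>f\<in>ops S. args S f \<noteq> [] \<and> (\<forall>A\<in>set (args S f). wf_ty S A) \<and> wf_ty S (res S f))"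

definition wf_ctx :: "('g, 'f, 'z) sig_scheme \<Rightarrow> 'g ctx \<Rightarrow> bool" where
  "wf_ctx S \<Gamma> \<longleftrightarrow> distinct (map fst \<Gamma>) \<and> (\<forall>(x, A)\<in>set \<Gamma>. wf_ty S A)"

text \<open>\<open>Sf [\<Gamma>\<^sub>1, \<dots>, \<Gamma>\<^sub>n]\<close> is the set of interleavings of the lists \<open>\<Gamma>\<^sub>i\<close>.\<close>

primrec Sf :: "'a list list \<Rightarrow> 'a list set" where
  "Sf [] = {[]}"
| "Sf (\<Gamma> # \<Gamma>s) = (\<Union>\<Delta>\<in>Sf \<Gamma>s. shuffles \<Gamma> \<Delta>)"

inductive typing :: "('g, 'f, 'z) sig_scheme \<Rightarrow> 'g ctx \<Rightarrow> ('g, 'f) trm \<Rightarrow> 'g ty \<Rightarrow> bool"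
  for S :: "('g, 'f, 'z) sig_scheme" where
  ty_Var: "wf_ctx S [(x, A)] \<Longrightarrow> typing S [(x, A)] (Var x) A"
| ty_Op: "\<lbrakk>f \<in> ops S; length \<Gamma>s = length (args S f); length vs = length (args S f);
    \<forall>i<length (args S f). typing S (\<Gamma>s ! i) (vs ! i) (args S f ! i);
    E \<in> Sf \<Gamma>s; wf_ctx S E\<rbrakk>
    \<Longrightarrow> typing S E (Op f vs) (res S f)"
| ty_Star: "typing S [] Star Unit"
| ty_LetStar: "\<lbrakk>typing S \<Gamma> v Unit; typing S \<Delta> w A; E \<in> Sf [\<Gamma>, \<Delta>]; wf_ctx S E\<rbrakk>
    \<Longrightarrow> typing S E (LetStar v w) A"
| ty_Tens: "\<lbrakk>typing S \<Gamma> v A; typing S \<Delta> w B; E \<in> Sf [\<Gamma>, \<Delta>]; wf_ctx S E\<rbrakk>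
    \<Longrightarrow> typing S E (Tens v w) (Tensor A B)"
| ty_PM: "\<lbrakk>typing S \<Gamma> v (Tensor A B); typing S (\<Delta> @ [(x, A), (y, B)]) w D;
    E \<in> Sf [\<Gamma>, \<Delta>]; wf_ctx S E\<rbrakk>
    \<Longrightarrow> typing S E (PM v x y w) D"
| ty_LAM: "typing S (\<Gamma> @ [(x, A)]) v B \<Longrightarrow> typing S \<Gamma> (LAM x A v) (Lolli A B)"
| ty_App: "\<lbrakk>typing S \<Gamma> v (Lolli A B); typing S \<Delta> w A; E \<in> Sf [\<Gamma>, \<Delta>]; wf_ctx S E\<rbrakk>
    \<Longrightarrow> typing S E (App v w) B"

section \<open>Linear theories and their theorems\<close>

text \<open>\<open>(\<Gamma>, v, q, w, A)\<close> stands for the equation-in-context \<open>\<Gamma> \<rhd> v =\<^sub>q w : A\<close>.\<close>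

type_synonym ('g, 'f, 'v) veq = "'g ctx \<times> ('g, 'f) trm \<times> 'v \<times> ('g, 'f) trm \<times> 'g ty"

record ('g, 'f, 'v) vtheory = "('g, 'f) sig" +
  axioms :: "('g, 'f, 'v) veq set"

definition linear_vtheory :: "'v set \<Rightarrow> ('g, 'f, 'v) vtheory \<Rightarrow> bool" where
  "linear_vtheory B T \<longleftrightarrow> wf_sig T \<and>
     (\<forall>(\<Gamma>, v, q, w, A)\<in>axioms T. q \<in> B \<and> typing T \<Gamma> v A \<and> typing T \<Gamma> w A)"

inductive conv :: "('g, 'f, 'z) sig_scheme \<Rightarrow> 'g ctx \<Rightarrow> ('g, 'f) trm \<Rightarrow> ('g, 'f) trm \<Rightarrow> 'g ty \<Rightarrow> bool"
  for S :: "('g, 'f, 'z) sig_scheme" where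
  beta_Tensor: "\<lbrakk>typing S \<Gamma> v A; typing S \<Delta> w B; typing S (\<Theta> @ [(x, A), (y, B)]) u D;
    E \<in> Sf [\<Gamma>, \<Delta>, \<Theta>]; wf_ctx S E\<rbrakk>
    \<Longrightarrow> conv S E (PM (Tens v w) x y u) (psubst (Var(x := v, y := w)) u) D"
| eta_Tensor: "\<lbrakk>typing S \<Gamma> v (Tensor A B); typing S (\<Delta> @ [(z, Tensor A B)]) u D;
    wf_ctx S (\<Delta> @ [(x, A), (y, B)]); E \<in> Sf [\<Gamma>, \<Delta>]; wf_ctx S E\<rbrakk>
    \<Longrightarrow> conv S E (PM v x y (subst1 u z (Tens (Var x) (Var y)))) (subst1 u z v) D"
| beta_Unit: "typing S \<Gamma> v A \<Longrightarrow> conv S \<Gamma> (LetStar Star v) v A"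
| eta_Unit: "\<lbrakk>typing S \<Gamma> v Unit; typing S (\<Delta> @ [(z, Unit)]) w A; E \<in> Sf [\<Gamma>, \<Delta>]; wf_ctx S E\<rbrakk>
    \<Longrightarrow> conv S E (LetStar v (subst1 w z Star)) (subst1 w z v) A"
| beta_Lolli: "\<lbrakk>typing S (\<Gamma> @ [(x, A)]) v B; typing S \<Delta> w A; E \<in> Sf [\<Gamma>, \<Delta>]; wf_ctx S E\<rbrakk>
    \<Longrightarrow> conv S E (App (LAM x A v) w) (subst1 v x w) B"
| eta_Lolli: "\<lbrakk>typing S \<Gamma> v (Lolli A B); wf_ctx S (\<Gamma> @ [(x, A)])\<rbrakk>
    \<Longrightarrow> conv S \<Gamma> (LAM x A (App v (Var x))) v (Lolli A B)"
| comm_Unit: "\<lbrakk>typing S \<Gamma> v Unit; typing S \<Delta> w A; typing S (\<Theta> @ [(z, A)]) u B;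
    E \<in> Sf [\<Gamma>, \<Delta>, \<Theta>]; wf_ctx S E\<rbrakk>
    \<Longrightarrow> conv S E (subst1 u z (LetStar v w)) (LetStar v (subst1 u z w)) B"
| comm_Tensor: "\<lbrakk>typing S \<Gamma> v (Tensor A B); typing S (\<Delta> @ [(x, A), (y, B)]) w D;
    typing S (\<Theta> @ [(z, D)]) u D'; x \<notin> fst ` set \<Theta>; y \<notin> fst ` set \<Theta>;
    E \<in> Sf [\<Gamma>, \<Delta>, \<Theta>]; wf_ctx S E\<rbrakk>
    \<Longrightarrow> conv S E (subst1 u z (PM v x y w)) (PM v x y (subst1 u z w)) D'"

inductive provable :: "'v::integral_quantale set \<Rightarrow> ('g, 'f, 'v) vtheory \<Rightarrow>
    'g ctx \<Rightarrow> ('g, 'f) trm \<Rightarrow> 'v \<Rightarrow> ('g, 'f) trm \<Rightarrow> 'g ty \<Rightarrow> bool"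
  for B :: "'v set" and T :: "('g, 'f, 'v) vtheory" where
  axiom: "(\<Gamma>, v, q, w, A) \<in> axioms T \<Longrightarrow> provable B T \<Gamma> v q w A"
| conv: "conv T \<Gamma> v w A \<Longrightarrow> provable B T \<Gamma> v top w A"
| conv_sym: "conv T \<Gamma> v w A \<Longrightarrow> provable B T \<Gamma> w top v A"
| refl: "typing T \<Gamma> v A \<Longrightarrow> provable B T \<Gamma> v top v A"
| trans: "\<lbrakk>provable B T \<Gamma> v q w A; provable B T \<Gamma> w r u A\<rbrakk> \<Longrightarrow> provable B T \<Gamma> v (q * r) u A"
| weak: "\<lbrakk>provable B T \<Gamma> v q w A; r \<in> B; r \<le> q\<rbrakk> \<Longrightarrow> provable B T \<Gamma> v r w A"
| arch: "\<lbrakk>typing T \<Gamma> v A; typing T \<Gamma> w A; q \<in> B; \<forall>r\<in>B. r \<lless> q \<longrightarrow> provable B T \<Gamma> v r w A\<rbrakk>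
    \<Longrightarrow> provable B T \<Gamma> v q w A"
| join: "\<lbrakk>typing T \<Gamma> v A; typing T \<Gamma> w A; finite Q; \<forall>q\<in>Q. provable B T \<Gamma> v q w A\<rbrakk>
    \<Longrightarrow> provable B T \<Gamma> v (Sup Q) w A"
| cong_Op: "\<lbrakk>f \<in> ops T; length \<Gamma>s = length (args T f); length vs = length (args T f);
    length ws = length (args T f); length qs = length (args T f);
    \<forall>i<length (args T f). provable B T (\<Gamma>s ! i) (vs ! i) (qs ! i) (ws ! i) (args T f ! i);
    E \<in> Sf \<Gamma>s; wf_ctx T E\<rbrakk>
    \<Longrightarrow> provable B T E (Op f vs) (prod_list qs) (Op f ws) (res T f)"
| cong_LetStar: "\<lbrakk>provable B T \<Gamma> v q w Unit; provable B T \<Delta> v' r w' A; E \<in> Sf [\<Gamma>, \<Delta>]; wf_ctx T E\<rbrakk>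
    \<Longrightarrow> provable B T E (LetStar v v') (q * r) (LetStar w w') A"
| cong_Tens: "\<lbrakk>provable B T \<Gamma> v q w A; provable B T \<Delta> v' r w' A'; E \<in> Sf [\<Gamma>, \<Delta>]; wf_ctx T E\<rbrakk>
    \<Longrightarrow> provable B T E (Tens v v') (q * r) (Tens w w') (Tensor A A')"
| cong_PM: "\<lbrakk>provable B T \<Gamma> v q w (Tensor A A');
    provable B T (\<Delta> @ [(x, A), (y, A')]) v' r w' D; E \<in> Sf [\<Gamma>, \<Delta>]; wf_ctx T E\<rbrakk>
    \<Longrightarrow> provable B T E (PM v x y v') (q * r) (PM w x y w') D"
| cong_LAM: "provable B T (\<Gamma> @ [(x, A)]) v q w A'
    \<Longrightarrow> provable B T \<Gamma> (LAM x A v) q (LAM x A w) (Lolli A A')"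
| cong_App: "\<lbrakk>provable B T \<Gamma> v q w (Lolli A A'); provable B T \<Delta> v' r w' A;
    E \<in> Sf [\<Gamma>, \<Delta>]; wf_ctx T E\<rbrakk>
    \<Longrightarrow> provable B T E (App v v') (q * r) (App w w') A'"
| subst: "\<lbrakk>provable B T (\<Gamma> @ [(x, A)]) v q w A'; provable B T \<Delta> v' r w' A; wf_ctx T (\<Gamma> @ \<Delta>)\<rbrakk>
    \<Longrightarrow> provable B T (\<Gamma> @ \<Delta>) (subst1 v x v') (q * r) (subst1 w x w') A'"
| perm: "\<lbrakk>provable B T \<Gamma> v q w A; mset \<Delta> = mset \<Gamma>\<rbrakk> \<Longrightarrow> provable B T \<Delta> v q w A"

definition terms_in :: "('g, 'f, 'v) vtheory \<Rightarrow> var \<Rightarrow> 'g ty \<Rightarrow> 'g ty \<Rightarrow> ('g, 'f) trm set" where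
  "terms_in T x A A' = {v. typing T [(x, A)] v A'}"

definition syn_dist :: "'v::integral_quantale set \<Rightarrow> ('g, 'f, 'v) vtheory \<Rightarrow> var \<Rightarrow>
    'g ty \<Rightarrow> 'g ty \<Rightarrow> ('g, 'f) trm \<Rightarrow> ('g, 'f) trm \<Rightarrow> 'v" where
  "syn_dist B T x A A' v w = Sup {q \<in> B. provable B T [(x, A)] v q w A'}"

definition syn_hom :: "'v::integral_quantale set \<Rightarrow> ('g, 'f, 'v) vtheory \<Rightarrow> var \<Rightarrow>
    'g ty \<Rightarrow> 'g ty \<Rightarrow> ('g, 'f) trm set set" where
  "syn_hom B T x A A' = terms_in T x A A' //
     {(v, w). v \<in> terms_in T x A A' \<and> w \<in> terms_in T x A A' \<and>
        1 \<le> syn_dist B T x A A' v w \<and> 1 \<le> syn_dist B T x A A' w v}"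

text \<open>
  The choice of the variable \<open>x\<close> in \<open>syn_hom\<close> is immaterial, so all choices are considered.
\<close>

definition varietal :: "'k rel \<Rightarrow> 'v::integral_quantale set \<Rightarrow> ('g, 'f, 'v) vtheory \<Rightarrow> bool" where
  "varietal \<kappa> B T \<longleftrightarrow> (\<forall>x A A'. wf_ty T A \<longrightarrow> wf_ty T A' \<longrightarrow> small \<kappa> (syn_hom B T x A A'))"

section \<open>Interpretation of terms\<close>

fun tens_objs :: "('o, 'm, 'v, 'z) autcat_scheme \<Rightarrow> 'o list \<Rightarrow> 'o" where
  "tens_objs C [] = \<I>\<^bsub>C\<^esub>"
| "tens_objs C (X # Xs) = foldl (tensor_obj C) X Xs"

fun tens_arrs :: "('o, 'm, 'v, 'z) autcat_scheme \<Rightarrow> 'm list \<Rightarrow> 'm" where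
  "tens_arrs C [] = id_arr C \<I>\<^bsub>C\<^esub>"
| "tens_arrs C (f # fs) = foldl (tensor_arr C) f fs"

text \<open>
  \<open>join2_rev C Xs (rev Ys)\<close> is the coherence isomorphism from
  \<open>tens_objs C Xs \<otimes> tens_objs C Ys\<close> to \<open>tens_objs C (Xs @ Ys)\<close>.
\<close>

fun join2_rev :: "('o, 'm, 'v, 'z) autcat_scheme \<Rightarrow> 'o list \<Rightarrow> 'o list \<Rightarrow> 'm" where
  "join2_rev C Xs [] = runit C (tens_objs C Xs)"
| "join2_rev C Xs [Y] = (if Xs = [] then lunit C Y else id_arr C (tens_objs C Xs \<otimes>\<^bsub>C\<^esub> Y))"
| "join2_rev C Xs (Y # Y' # Ys) =
     (join2_rev C Xs (Y' # Ys) \<boxtimes>\<^bsub>C\<^esub> id_arr C Y) \<cdot>\<^bsub>C\<^esub>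
     inv_arr C (assoc C (tens_objs C Xs) (tens_objs C (rev (Y' # Ys))) Y)"

fun join_rev :: "('o, 'm, 'v, 'z) autcat_scheme \<Rightarrow> 'o list list \<Rightarrow> 'm" where
  "join_rev C [] = id_arr C \<I>\<^bsub>C\<^esub>"
| "join_rev C [Xs] = id_arr C (tens_objs C Xs)"
| "join_rev C (Ys # Xs # Xss) =
     join2_rev C (concat (rev (Xs # Xss))) (rev Ys) \<cdot>\<^bsub>C\<^esub>
     (join_rev C (Xs # Xss) \<boxtimes>\<^bsub>C\<^esub> id_arr C (tens_objs C Ys))"

text \<open>
  \<open>join C [Xs\<^sub>1, \<dots>, Xs\<^sub>n]\<close> is the coherence isomorphism from the \<open>n\<close>-fold tensor of the
  \<open>tens_objs C Xs\<^sub>i\<close> to \<open>tens_objs C (Xs\<^sub>1 @ \<dots> @ Xs\<^sub>n)\<close>, and \<open>split\<close> is its inverse.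
\<close>

definition join :: "('o, 'm, 'v, 'z) autcat_scheme \<Rightarrow> 'o list list \<Rightarrow> 'm" where
  "join C Xss = join_rev C (rev Xss)"

definition split :: "('o, 'm, 'v, 'z) autcat_scheme \<Rightarrow> 'o list list \<Rightarrow> 'm" where
  "split C Xss = inv_arr C (join C Xss)"

text \<open>
  \<open>shuffle C ob E D\<close> is the symmetry from \<open>tens_objs C (map ob E)\<close> to \<open>tens_objs C (map ob D)\<close>
  that realises the permutation taking the list \<open>E\<close> of distinct elements to \<open>D\<close>. The first
  element of \<open>D\<close> is moved to the front of \<open>E\<close>, and then the remaining elements are rearranged.
\<close>

definition front :: "('o, 'm, 'v, 'z) autcat_scheme \<Rightarrow> 'o list \<Rightarrow> 'o \<Rightarrow> 'o list \<Rightarrow> 'm" where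
  "front C Xs Y Zs = join C [[Y], Xs, Zs] \<cdot>\<^bsub>C\<^esub>
     (braid C (tens_objs C Xs) Y \<boxtimes>\<^bsub>C\<^esub> id_arr C (tens_objs C Zs)) \<cdot>\<^bsub>C\<^esub> split C [Xs, [Y], Zs]"

fun shuffle :: "('o, 'm, 'v, 'z) autcat_scheme \<Rightarrow> ('a \<Rightarrow> 'o) \<Rightarrow> 'a list \<Rightarrow> 'a list \<Rightarrow> 'm" where
  "shuffle C ob E [] = id_arr C \<I>\<^bsub>C\<^esub>"
| "shuffle C ob E (d # D) =
     (let E1 = takeWhile (\<lambda>e. e \<noteq> d) E; E2 = tl (dropWhile (\<lambda>e. e \<noteq> d) E)
      in join C [[ob d], map ob D] \<cdot>\<^bsub>C\<^esub> (id_arr C (ob d) \<boxtimes>\<^bsub>C\<^esub> shuffle C ob (E1 @ E2) D) \<cdot>\<^bsub>C\<^esub>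
         split C [[ob d], map ob (E1 @ E2)] \<cdot>\<^bsub>C\<^esub> front C (map ob E1) (ob d) (map ob E2))"

text \<open>\<open>gi\<close> interprets the ground types and \<open>oi\<close> the operation symbols.\<close>

primrec ty_obj :: "('o, 'm, 'v, 'z) autcat_scheme \<Rightarrow> ('g \<Rightarrow> 'o) \<Rightarrow> 'g ty \<Rightarrow> 'o" where
  "ty_obj C gi (Ground X) = gi X"
| "ty_obj C gi Unit = \<I>\<^bsub>C\<^esub>"
| "ty_obj C gi (Tensor A B) = ty_obj C gi A \<otimes>\<^bsub>C\<^esub> ty_obj C gi B"
| "ty_obj C gi (Lolli A B) = ty_obj C gi A \<multimap>\<^bsub>C\<^esub> ty_obj C gi B"

abbreviation ctx_objs :: "('o, 'm, 'v, 'z) autcat_scheme \<Rightarrow> ('g \<Rightarrow> 'o) \<Rightarrow> 'g ctx \<Rightarrow> 'o list" where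
  "ctx_objs C gi \<Gamma> \<equiv> map (\<lambda>(x, A). ty_obj C gi A) \<Gamma>"

abbreviation ctx_obj :: "('o, 'm, 'v, 'z) autcat_scheme \<Rightarrow> ('g \<Rightarrow> 'o) \<Rightarrow> 'g ctx \<Rightarrow> 'o" where
  "ctx_obj C gi \<Gamma> \<equiv> tens_objs C (ctx_objs C gi \<Gamma>)"

text \<open>
  \<open>ctx_split C gi [\<Gamma>\<^sub>1, \<dots>, \<Gamma>\<^sub>n] E\<close> goes from the interpretation of a shuffle \<open>E\<close> of the \<open>\<Gamma>\<^sub>i\<close>
  to the tensor of the interpretations of the \<open>\<Gamma>\<^sub>i\<close>.
\<close>

definition ctx_split :: "('o, 'm, 'v, 'z) autcat_scheme \<Rightarrow> ('g \<Rightarrow> 'o) \<Rightarrow> 'g ctx list \<Rightarrow> 'g ctx \<Rightarrow> 'm" where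
  "ctx_split C gi \<Gamma>s E =
     split C (map (ctx_objs C gi) \<Gamma>s) \<cdot>\<^bsub>C\<^esub> shuffle C (\<lambda>(x, A). ty_obj C gi A) E (concat \<Gamma>s)"

text \<open>
  \<open>interp S C gi oi \<Gamma> v A m\<close>: the judgement \<open>\<Gamma> \<rhd> v : A\<close> is derivable and is interpreted by the
  arrow \<open>m\<close> from \<open>ctx_obj C gi \<Gamma>\<close> to \<open>ty_obj C gi A\<close>.
\<close>

inductive interp :: "('g, 'f, 'y) sig_scheme \<Rightarrow> ('o, 'm, 'v, 'z) autcat_scheme \<Rightarrow> ('g \<Rightarrow> 'o) \<Rightarrow> ('f \<Rightarrow> 'm) \<Rightarrow>
    'g ctx \<Rightarrow> ('g, 'f) trm \<Rightarrow> 'g ty \<Rightarrow> 'm \<Rightarrow> bool"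
  for S :: "('g, 'f, 'y) sig_scheme" and C :: "('o, 'm, 'v, 'z) autcat_scheme" (structure)
    and gi :: "'g \<Rightarrow> 'o" and oi :: "'f \<Rightarrow> 'm" where
  in_Var: "wf_ctx S [(x, A)] \<Longrightarrow> interp S C gi oi [(x, A)] (Var x) A (id_arr C (ty_obj C gi A))"
| in_Op: "\<lbrakk>f \<in> ops S; length \<Gamma>s = length (args S f); length vs = length (args S f);
    length ms = length (args S f);
    \<forall>i<length (args S f). interp S C gi oi (\<Gamma>s ! i) (vs ! i) (args S f ! i) (ms ! i);
    E \<in> Sf \<Gamma>s; wf_ctx S E\<rbrakk>
    \<Longrightarrow> interp S C gi oi E (Op f vs) (res S f) (oi f \<cdot> tens_arrs C ms \<cdot> ctx_split C gi \<Gamma>s E)"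
| in_Star: "interp S C gi oi [] Star Unit (id_arr C \<I>)"
| in_LetStar: "\<lbrakk>interp S C gi oi \<Gamma> v Unit m; interp S C gi oi \<Delta> w A n;
    E \<in> Sf [\<Gamma>, \<Delta>]; wf_ctx S E\<rbrakk>
    \<Longrightarrow> interp S C gi oi E (LetStar v w) A
      (n \<cdot> lunit C (ctx_obj C gi \<Delta>) \<cdot> (m \<boxtimes> id_arr C (ctx_obj C gi \<Delta>)) \<cdot> ctx_split C gi [\<Gamma>, \<Delta>] E)"
| in_Tens: "\<lbrakk>interp S C gi oi \<Gamma> v A m; interp S C gi oi \<Delta> w B n;
    E \<in> Sf [\<Gamma>, \<Delta>]; wf_ctx S E\<rbrakk>
    \<Longrightarrow> interp S C gi oi E (Tens v w) (Tensor A B) ((m \<boxtimes> n) \<cdot> ctx_split C gi [\<Gamma>, \<Delta>] E)"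
| in_PM: "\<lbrakk>interp S C gi oi \<Gamma> v (Tensor A B) m; interp S C gi oi (\<Delta> @ [(x, A), (y, B)]) w D n;
    E \<in> Sf [\<Gamma>, \<Delta>]; wf_ctx S E\<rbrakk>
    \<Longrightarrow> interp S C gi oi E (PM v x y w) D
      (n \<cdot> join C [ctx_objs C gi \<Delta>, [ty_obj C gi A], [ty_obj C gi B]]
         \<cdot> inv_arr C (assoc C (ctx_obj C gi \<Delta>) (ty_obj C gi A) (ty_obj C gi B))
         \<cdot> braid C (ty_obj C gi (Tensor A B)) (ctx_obj C gi \<Delta>)
         \<cdot> (m \<boxtimes> id_arr C (ctx_obj C gi \<Delta>)) \<cdot> ctx_split C gi [\<Gamma>, \<Delta>] E)"
| in_LAM: "interp S C gi oi (\<Gamma> @ [(x, A)]) v B m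
    \<Longrightarrow> interp S C gi oi \<Gamma> (LAM x A v) (Lolli A B)
      (curry_arr C (ctx_obj C gi \<Gamma>) (ty_obj C gi A) (ty_obj C gi B)
        (m \<cdot> join C [ctx_objs C gi \<Gamma>, [ty_obj C gi A]]))"
| in_App: "\<lbrakk>interp S C gi oi \<Gamma> v (Lolli A B) m; interp S C gi oi \<Delta> w A n;
    E \<in> Sf [\<Gamma>, \<Delta>]; wf_ctx S E\<rbrakk>
    \<Longrightarrow> interp S C gi oi E (App v w) B
      (eval_arr C (ty_obj C gi A) (ty_obj C gi B) \<cdot> (m \<boxtimes> n) \<cdot> ctx_split C gi [\<Gamma>, \<Delta>] E)"

definition satisfied :: "('g, 'f, 'y) sig_scheme \<Rightarrow> ('o, 'm, 'v::order, 'z) autcat_scheme \<Rightarrow>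
    ('g \<Rightarrow> 'o) \<Rightarrow> ('f \<Rightarrow> 'm) \<Rightarrow> ('g, 'f, 'v) veq \<Rightarrow> bool" where
  "satisfied S C gi oi = (\<lambda>(\<Gamma>, v, q, w, A).
     \<exists>m n. interp S C gi oi \<Gamma> v A m \<and> interp S C gi oi \<Gamma> w A n \<and> q \<le> dist C m n)"

section \<open>The internal language of a category\<close>

text \<open>
  The operation symbols are the arrows of the category and, for every type \<open>A\<close>, the mutually
  inverse symbols \<open>To A : A \<rightarrow> i(A)\<close> and \<open>From A : i(A) \<rightarrow> A\<close>, where the object \<open>i(A)\<close> is
  regarded as a ground type.
\<close>

datatype ('o, 'm) lang_op = Mor 'm | To "'o ty" | From "'o ty"

abbreviation lang_i :: "('o, 'm, 'v) autcat \<Rightarrow> 'o ty \<Rightarrow> 'o" where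
  "lang_i C \<equiv> ty_obj C (\<lambda>X. X)"

primrec lang_args :: "('o, 'm, 'v) autcat \<Rightarrow> ('o, 'm) lang_op \<Rightarrow> 'o ty list" where
  "lang_args C (Mor f) = [Ground (Dom C f)]"
| "lang_args C (To A) = [A]"
| "lang_args C (From A) = [Ground (lang_i C A)]"

primrec lang_res :: "('o, 'm, 'v) autcat \<Rightarrow> ('o, 'm) lang_op \<Rightarrow> 'o ty" where
  "lang_res C (Mor f) = Ground (Cod C f)"
| "lang_res C (To A) = Ground (lang_i C A)"
| "lang_res C (From A) = A"

definition lang_sig :: "('o, 'm, 'v) autcat \<Rightarrow> ('o, ('o, 'm) lang_op) sig" where
  "lang_sig C = \<lparr>grounds = Obj C,
     ops = Mor ` Arr C \<union> {To A |A. set_ty A \<subseteq> Obj C} \<union> {From A |A. set_ty A \<subseteq> Obj C},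
     args = lang_args C, res = lang_res C\<rparr>"

text \<open>
  Types are interpreted by \<open>i\<close>, so that \<open>A\<close> and the ground type \<open>i(A)\<close> have the same interpretation.
\<close>

primrec lang_op_arr :: "('o, 'm, 'v) autcat \<Rightarrow> ('o, 'm) lang_op \<Rightarrow> 'm" where
  "lang_op_arr C (Mor f) = f"
| "lang_op_arr C (To A) = id_arr C (lang_i C A)"
| "lang_op_arr C (From A) = id_arr C (lang_i C A)"

definition Lang :: "'v::integral_quantale set \<Rightarrow> ('o, 'm, 'v) autcat \<Rightarrow>
    ('o, ('o, 'm) lang_op, 'v) vtheory" where
  "Lang B C = sig.extend (lang_sig C)
     (vtheory.fields {(\<Gamma>, v, q, w, A). q \<in> B \<and>
        satisfied (lang_sig C) C (\<lambda>X. X) (lang_op_arr C) (\<Gamma>, v, q, w, A)})"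

end

theory Submission
  imports Defs
begin

text \<open>
  Every term \<open>x : A \<rhd> v : A'\<close> has an interpretation, which is an arrow from \<open>i(A)\<close> to \<open>i(A')\<close>. If two
  terms have a common interpretation \<open>m\<close>, then the two equations between them with label \<open>1\<close> are
  axioms of the internal language, because \<open>1 \<le> dist m m\<close>; hence the terms are in the same
  class. Choosing one interpretation for each class thus embeds the syntactic hom into the small set
  of arrows from \<open>i(A)\<close> to \<open>i(A')\<close>. Neither soundness nor uniqueness of the interpretation matters.
\<close>

section \<open>Typing\<close>

lemma Sf_mset: "E \<in> Sf \<Gamma>s \<Longrightarrow> mset E = mset (concat \<Gamma>s)"
  by (induction \<Gamma>s arbitrary: E) (auto dest: mset_shuffles)

lemma Sf_set: "E \<in> Sf \<Gamma>s \<Longrightarrow> set E = (\<Union>\<Gamma>\<in>set \<Gamma>s. set \<Gamma>)"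
  using Sf_mset[THEN mset_eq_setD] by auto

lemma typing_wf_ctx: "typing S \<Gamma> v A \<Longrightarrow> wf_ctx S \<Gamma>"
  by (induction rule: typing.induct) (auto simp: wf_ctx_def)

text \<open>For \<open>ty_LAM\<close>, the domain \<open>A\<close> occurs in the context of the
  body, so \<open>typing_wf_ctx\<close> makes it well formed; for \<open>ty_Op\<close>,
  \<open>wf_sig\<close> covers the result type.\<close>

lemma typing_wf_ty: "typing S \<Gamma> v A \<Longrightarrow> wf_sig S \<Longrightarrow> wf_ty S A"
proof (induction rule: typing.induct)
  case (ty_LAM \<Gamma> x A v B)
  then show ?case
    using typing_wf_ctx[OF ty_LAM.hyps(1)] by (auto simp: wf_ctx_def wf_ty_def)
qed (auto simp: wf_ctx_def wf_ty_def wf_sig_def)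

text \<open>Typing reads only these four fields. \<open>S\<close> and \<open>S'\<close> may be
  records of different types, which allows passing between \<open>lang_sig C\<close> and its
  extension \<open>Lang B C\<close>.\<close>

lemma typing_cong:
  assumes "typing S \<Gamma> v A"
    and sig: "grounds S = grounds S'" "ops S = ops S'" "args S = args S'" "res S = res S'"
  shows "typing S' \<Gamma> v A"
proof -
  have wf: "wf_ctx S = wf_ctx S'"
    using sig by (simp add: wf_ctx_def wf_ty_def fun_eq_iff)
  from assms(1) show ?thesis
    by (induction rule: typing.induct) (use sig wf in \<open>auto intro!: typing.intros\<close>)
qed

text \<open>Each rule of \<open>interp\<close> is a typing rule decorated with arrows, so a
  derivation becomes a typing derivation once the arrows are forgotten.\<close>

lemma interp_typing: "interp S C gi oi \<Gamma> v A m \<Longrightarrow> typing S \<Gamma> v A"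
  by (induction rule: interp.induct) (blast intro: typing.intros)+

section \<open>Coherence isomorphisms\<close>

text \<open>Tensors of lists are nested to the left and a singleton carries no unit factor, so the
  inductions below peel lists from the end and treat singletons separately.\<close>

lemma tens_objs_snoc: "tens_objs C (Xs @ [Y]) = (if Xs = [] then Y else tens_objs C Xs \<otimes>\<^bsub>C\<^esub> Y)"
  by (cases Xs) auto

section \<open>Isomorphisms in a category\<close>

context category
begin

lemma hom_Dom_Obj: "f \<in> hom C X Y \<Longrightarrow> X \<in> Obj C"
  using Dom_Obj by (auto simp: hom_def)

lemma hom_Cod_Obj: "f \<in> hom C X Y \<Longrightarrow> Y \<in> Obj C"
  using Cod_Obj by (auto simp: hom_def)

lemma iso_arrs_hom: "f \<in> iso_arrs C X Y \<Longrightarrow> f \<in> hom C X Y"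
  by (simp add: iso_arrs_def)

lemma iso_arrsI:
  assumes "f \<in> hom C X Y" "g \<in> hom C Y X" "g \<cdot> f = id_arr C X" "f \<cdot> g = id_arr C Y"
  shows "f \<in> iso_arrs C X Y"
  using assms by (auto simp: iso_arrs_def is_inverse_def hom_def)

lemma iso_arrsE:
  assumes "f \<in> iso_arrs C X Y"
  obtains g where "f \<in> hom C X Y" "g \<in> hom C Y X" "g \<cdot> f = id_arr C X" "f \<cdot> g = id_arr C Y"
  using assms by (auto simp: iso_arrs_def is_inverse_def hom_def)

lemma id_iso: "X \<in> Obj C \<Longrightarrow> id_arr C X \<in> iso_arrs C X X"
  by (meson Comp_Id Id_hom iso_arrsI)

text \<open>Since \<open>inv_arr\<close> is a definite description, uniqueness of inverses comes
  first: h = h (f g) = (h f) g = g.\<close>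

lemma inv_arr_iso:
  assumes "f \<in> iso_arrs C X Y"
  shows "inv_arr C f \<in> iso_arrs C Y X"
proof -
  have f: "f \<in> hom C X Y" and D: "Dom C f = X" "Cod C f = Y"
    using assms by (auto simp: iso_arrs_def hom_def)
  obtain g where g: "is_inverse C f g"
    using assms by (auto simp: iso_arrs_def)
  have "h = g" if h: "is_inverse C f h" for h
  proof -
    have "h = h \<cdot> (f \<cdot> g)"
      using g h D Comp_Id[of h Y X] by (simp add: is_inverse_def)
    also have "\<dots> = (h \<cdot> f) \<cdot> g"
      using g h f D Comp_assoc[of g Y X f Y h X] by (simp add: is_inverse_def)
    also have "\<dots> = g"
      using g h D Id_Comp[of g Y X] by (simp add: is_inverse_def)
    finally show ?thesis .
  qed
  then have "inv_arr C f = g"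
    unfolding inv_arr_def using g by blast
  then show ?thesis
    using iso_arrsI[of g Y X f] f g D by (simp add: is_inverse_def)
qed

lemma Comp_iso:
  assumes "f \<in> iso_arrs C X Y" "g \<in> iso_arrs C Y Z"
  shows "g \<cdot> f \<in> iso_arrs C X Z"
proof -
  obtain f' where f: "f \<in> hom C X Y" "f' \<in> hom C Y X" "f' \<cdot> f = id_arr C X" "f \<cdot> f' = id_arr C Y"
    using assms(1) by (rule iso_arrsE)
  obtain g' where g: "g \<in> hom C Y Z" "g' \<in> hom C Z Y" "g' \<cdot> g = id_arr C Y" "g \<cdot> g' = id_arr C Z"
    using assms(2) by (rule iso_arrsE)
  have gf: "g \<cdot> f \<in> hom C X Z" and fg: "f' \<cdot> g' \<in> hom C Z X"
    using f g Comp_hom by blast+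
  have "(f' \<cdot> g') \<cdot> (g \<cdot> f) = f' \<cdot> (g' \<cdot> g) \<cdot> f"
    using Comp_assoc[OF gf g(2) f(2)] Comp_assoc[OF f(1) g(1) g(2)] by simp
  also have "\<dots> = id_arr C X"
    using f g Id_Comp by simp
  finally have 1: "(f' \<cdot> g') \<cdot> (g \<cdot> f) = id_arr C X" .
  have "(g \<cdot> f) \<cdot> (f' \<cdot> g') = g \<cdot> (f \<cdot> f') \<cdot> g'"
    using Comp_assoc[OF fg f(1) g(1)] Comp_assoc[OF g(2) f(2) f(1)] by simp
  also have "\<dots> = id_arr C Z"
    using f g Id_Comp by simp
  finally show ?thesis
    using iso_arrsI[OF gf fg 1] by blast
qed

end

section \<open>Tensors of lists and their coherence isomorphisms\<close>

context symmetric_monoidal_category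
begin

lemma tensor_iso:
  assumes "f \<in> iso_arrs C X Y" "g \<in> iso_arrs C X' Y'"
  shows "f \<boxtimes> g \<in> iso_arrs C (X \<otimes> X') (Y \<otimes> Y')"
proof -
  obtain f' where f: "f \<in> hom C X Y" "f' \<in> hom C Y X" "f' \<cdot> f = id_arr C X" "f \<cdot> f' = id_arr C Y"
    using assms(1) by (rule iso_arrsE)
  obtain g' where g: "g \<in> hom C X' Y'" "g' \<in> hom C Y' X'" "g' \<cdot> g = id_arr C X'" "g \<cdot> g' = id_arr C Y'"
    using assms(2) by (rule iso_arrsE)
  have Obj: "X \<in> Obj C" "Y \<in> Obj C" "X' \<in> Obj C" "Y' \<in> Obj C"
    using f g hom_Dom_Obj by blast+
  have "(f' \<boxtimes> g') \<cdot> (f \<boxtimes> g) = id_arr C (X \<otimes> X')" "(f \<boxtimes> g) \<cdot> (f' \<boxtimes> g') = id_arr C (Y \<otimes> Y')"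
    using f g Obj tensor_Id tensor_Comp[OF f(1,2) g(1,2)] tensor_Comp[OF f(2,1) g(2,1)] by simp_all
  then show ?thesis
    using iso_arrsI[OF tensor_hom[OF f(1) g(1)] tensor_hom[OF f(2) g(2)]] by blast
qed

lemma tens_objs_Obj: "set Xs \<subseteq> Obj C \<Longrightarrow> tens_objs C Xs \<in> Obj C"
  by (induction Xs rule: rev_induct) (auto simp: tens_objs_snoc unit_Obj tensor_Obj)

lemma tens_arrs_hom:
  assumes "length Xs = length ms" "length Ys = length ms" "\<forall>i<length ms. ms ! i \<in> hom C (Xs ! i) (Ys ! i)"
  shows "tens_arrs C ms \<in> hom C (tens_objs C Xs) (tens_objs C Ys)"
proof -
  \<comment> \<open>\<open>tens_arrs\<close> folds with the first arrow as initial accumulator, so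
    the induction is over folds from an arbitrary accumulator \<open>m\<close>.\<close>
  have foldl: "foldl (tensor_arr C) m ms \<in> hom C (foldl (tensor_obj C) X Xs) (foldl (tensor_obj C) Y Ys)"
    if "length Xs = length ms" "length Ys = length ms" "m \<in> hom C X Y"
      "\<forall>i<length ms. ms ! i \<in> hom C (Xs ! i) (Ys ! i)" for m ms X Xs Y Ys
    using that
  proof (induction ms arbitrary: m X Y Xs Ys)
    case (Cons n ms)
    then obtain X' Xs' Y' Ys' where "Xs = X' # Xs'" "Ys = Y' # Ys'"
      by (auto simp: length_Suc_conv)
    with Cons show ?case
      by (force intro!: Cons.IH tensor_hom)
  qed auto
  show ?thesis
  proof (cases ms)
    case Nil
    then show ?thesis using assms Id_hom unit_Obj by simp
  next
    case (Cons n ns)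
    then obtain X' Xs' Y' Ys' where "Xs = X' # Xs'" "Ys = Y' # Ys'"
      using assms by (auto simp: length_Suc_conv)
    with Cons assms show ?thesis
      by (force intro!: foldl)
  qed
qed

text \<open>\<open>Ys\<close> lists the right-hand factors in reverse, so its head is the last
  factor. The inverse associator detaches that factor, the induction hypothesis joins the others,
  and \<open>tens_objs_snoc\<close> identifies the result.\<close>

lemma join2_rev_iso:
  assumes "set Xs \<subseteq> Obj C" "set Ys \<subseteq> Obj C"
  shows "join2_rev C Xs Ys \<in>
    iso_arrs C (tens_objs C Xs \<otimes> tens_objs C (rev Ys)) (tens_objs C (Xs @ rev Ys))"
  using assms(2)
proof (induction Ys rule: induct_list012)
  case 1
  then show ?case
    using assms(1) by (simp add: runit_iso tens_objs_Obj)
next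
  case (2 Y)
  then show ?case
    using assms(1) by (simp add: tens_objs_snoc lunit_iso id_iso tens_objs_Obj tensor_Obj)
next
  case (3 Y Y' Ys)
  let ?X = "tens_objs C Xs" and ?Z = "tens_objs C (rev (Y' # Ys))"
  have Obj: "?X \<in> Obj C" "?Z \<in> Obj C" "Y \<in> Obj C"
    using assms(1) 3 by (auto intro!: tens_objs_Obj)
  have "inv_arr C (assoc C ?X ?Z Y) \<in> iso_arrs C (?X \<otimes> (?Z \<otimes> Y)) ((?X \<otimes> ?Z) \<otimes> Y)"
    using Obj by (intro inv_arr_iso assoc_iso)
  moreover have "join2_rev C Xs (Y' # Ys) \<boxtimes> id_arr C Y \<in>
      iso_arrs C ((?X \<otimes> ?Z) \<otimes> Y) (tens_objs C (Xs @ rev (Y' # Ys)) \<otimes> Y)"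
    using Obj 3 by (intro tensor_iso id_iso) auto
  moreover have "tens_objs C (rev (Y # Y' # Ys)) = ?Z \<otimes> Y"
    "tens_objs C (Xs @ rev (Y # Y' # Ys)) = tens_objs C (Xs @ rev (Y' # Ys)) \<otimes> Y"
    using tens_objs_snoc[of C "rev (Y' # Ys)" Y] tens_objs_snoc[of C "Xs @ rev (Y' # Ys)" Y] by auto
  ultimately show ?case
    using Comp_iso by simp
qed

text \<open>Again the head of the reversed list is the last block: the earlier blocks are joined
  first, and \<open>join2_rev\<close> then appends this one.\<close>

lemma join_rev_iso:
  "set (concat Xss) \<subseteq> Obj C \<Longrightarrow> join_rev C Xss \<in>
    iso_arrs C (tens_objs C (map (tens_objs C) (rev Xss))) (tens_objs C (concat (rev Xss)))"
proof (induction Xss rule: induct_list012)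
  case 1
  then show ?case by (simp add: id_iso unit_Obj)
next
  case (2 Xs)
  then show ?case by (simp add: id_iso tens_objs_Obj)
next
  case (3 Ys Xs Xss)
  let ?X = "tens_objs C (map (tens_objs C) (rev (Xs # Xss)))" and ?Y = "tens_objs C Ys"
  let ?Z = "tens_objs C (concat (rev (Xs # Xss)))"
  have "join_rev C (Xs # Xss) \<boxtimes> id_arr C ?Y \<in> iso_arrs C (?X \<otimes> ?Y) (?Z \<otimes> ?Y)"
    using 3 by (intro tensor_iso id_iso tens_objs_Obj) auto
  moreover have "set (concat (rev (Xs # Xss))) \<subseteq> Obj C" "set (rev Ys) \<subseteq> Obj C"
    using 3(3) by auto
  then have "join2_rev C (concat (rev (Xs # Xss))) (rev Ys) \<in>
      iso_arrs C (?Z \<otimes> ?Y) (tens_objs C (concat (rev (Ys # Xs # Xss))))"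
    using join2_rev_iso[of "concat (rev (Xs # Xss))" "rev Ys"] by simp
  moreover have "tens_objs C (map (tens_objs C) (rev (Ys # Xs # Xss))) = ?X \<otimes> ?Y"
    using tens_objs_snoc[of C "map (tens_objs C) (rev (Xs # Xss))"] by simp
  ultimately show ?case
    using Comp_iso by (simp del: rev.simps)
qed

lemma join_iso:
  assumes "set (concat Xss) \<subseteq> Obj C"
  shows "join C Xss \<in> iso_arrs C (tens_objs C (map (tens_objs C) Xss)) (tens_objs C (concat Xss))"
  using join_rev_iso[of "rev Xss"] assms by (simp add: join_def)

lemma join_hom:
  assumes "set (concat Xss) \<subseteq> Obj C"
  shows "join C Xss \<in> hom C (tens_objs C (map (tens_objs C) Xss)) (tens_objs C (concat Xss))"
  using join_iso[OF assms] by (rule iso_arrs_hom)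

lemma split_hom:
  assumes "set (concat Xss) \<subseteq> Obj C"
  shows "split C Xss \<in> hom C (tens_objs C (concat Xss)) (tens_objs C (map (tens_objs C) Xss))"
  unfolding split_def using inv_arr_iso[OF join_iso[OF assms]] by (rule iso_arrs_hom)

lemma front_hom:
  assumes "set Xs \<subseteq> Obj C" "Y \<in> Obj C" "set Zs \<subseteq> Obj C"
  shows "front C Xs Y Zs \<in> hom C (tens_objs C (Xs @ Y # Zs)) (tens_objs C (Y # Xs @ Zs))"
proof -
  let ?X = "tens_objs C Xs" and ?Z = "tens_objs C Zs"
  have "split C [Xs, [Y], Zs] \<in> hom C (tens_objs C (Xs @ Y # Zs)) ((?X \<otimes> Y) \<otimes> ?Z)"
    using split_hom[of "[Xs, [Y], Zs]"] assms by auto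
  moreover have "braid C ?X Y \<boxtimes> id_arr C ?Z \<in> hom C ((?X \<otimes> Y) \<otimes> ?Z) ((Y \<otimes> ?X) \<otimes> ?Z)"
    using assms by (intro tensor_hom Id_hom iso_arrs_hom braid_iso tens_objs_Obj)
  moreover have "join C [[Y], Xs, Zs] \<in> hom C ((Y \<otimes> ?X) \<otimes> ?Z) (tens_objs C (Y # Xs @ Zs))"
    using join_hom[of "[[Y], Xs, Zs]"] assms by auto
  ultimately show ?thesis
    unfolding front_def by (blast intro: Comp_hom)
qed

text \<open>Equality of multisets ensures that the head of \<open>D\<close> occurs in
  \<open>E\<close>, and it persists after that occurrence is removed from \<open>E\<close>. Hence
  the induction leaves \<open>E\<close> arbitrary.\<close>

lemma shuffle_hom:
  assumes "mset E = mset D" "ob ` set D \<subseteq> Obj C"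
  shows "shuffle C ob E D \<in> hom C (tens_objs C (map ob E)) (tens_objs C (map ob D))"
  using assms
proof (induction D arbitrary: E)
  case Nil
  then show ?case by (simp add: Id_hom unit_Obj)
next
  case (Cons d D)
  \<comment> \<open>These are the two pieces bound by \<open>let\<close> in \<open>shuffle\<close>,
    before and after the first occurrence of \<open>d\<close>.\<close>
  define E1 E2 where "E1 = takeWhile (\<lambda>e. e \<noteq> d) E" and "E2 = tl (dropWhile (\<lambda>e. e \<noteq> d) E)"
  have "d \<in> set E"
    using Cons.prems(1) mset_eq_setD by fastforce
  then have "dropWhile (\<lambda>e. e \<noteq> d) E \<noteq> []" "hd (dropWhile (\<lambda>e. e \<noteq> d) E) = d"
    using hd_dropWhile[of "\<lambda>e. e \<noteq> d" E] by auto
  then have E: "E = E1 @ d # E2"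
    unfolding E1_def E2_def by (metis list.collapse takeWhile_dropWhile_id)
  have mset: "mset (E1 @ E2) = mset D"
    using Cons.prems(1) E by simp
  then have set: "set E1 \<union> set E2 = set D"
    using mset_eq_setD[OF mset] by simp
  let ?E = "tens_objs C (map ob (E1 @ E2))" and ?D = "tens_objs C (map ob D)"
  have "front C (map ob E1) (ob d) (map ob E2) \<in>
      hom C (tens_objs C (map ob E)) (tens_objs C (ob d # map ob (E1 @ E2)))"
    using front_hom[of "map ob E1" "ob d" "map ob E2"] Cons.prems(2) E set by auto
  moreover have "split C [[ob d], map ob (E1 @ E2)] \<in>
      hom C (tens_objs C (ob d # map ob (E1 @ E2))) (ob d \<otimes> ?E)"
    using split_hom[of "[[ob d], map ob (E1 @ E2)]"] Cons.prems(2) set by auto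
  moreover have "id_arr C (ob d) \<boxtimes> shuffle C ob (E1 @ E2) D \<in> hom C (ob d \<otimes> ?E) (ob d \<otimes> ?D)"
    using Cons.prems(2) by (intro tensor_hom Id_hom Cons.IH mset) auto
  moreover have "join C [[ob d], map ob D] \<in> hom C (ob d \<otimes> ?D) (tens_objs C (map ob (d # D)))"
    using join_hom[of "[[ob d], map ob D]"] Cons.prems(2) by auto
  \<comment> \<open>Composition associates to the right, so \<open>Comp_hom\<close> descends to the
    rightmost factor; matching it with its assumption fixes the intermediate objects from right to
    left.\<close>
  ultimately show ?case
    unfolding shuffle.simps Let_def E1_def[symmetric] E2_def[symmetric]
    by - (assumption | rule Comp_hom)+
qed

lemma ctx_split_hom:
  assumes "E \<in> Sf \<Gamma>s" "set (ctx_objs C gi E) \<subseteq> Obj C"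
  shows "ctx_split C gi \<Gamma>s E \<in> hom C (ctx_obj C gi E) (tens_objs C (map (ctx_obj C gi) \<Gamma>s))"
proof -
  let ?ob = "\<lambda>(x, A). ty_obj C gi A"
  \<comment> \<open>An interleaving has the same entries as the lists it interleaves, so the
    assumption on \<open>E\<close> transfers to all of \<open>\<Gamma>s\<close>.\<close>
  have "?ob ` set (concat \<Gamma>s) \<subseteq> Obj C"
    using assms Sf_set[OF assms(1)] by auto
  then have "shuffle C ?ob E (concat \<Gamma>s) \<in> hom C (ctx_obj C gi E) (ctx_obj C gi (concat \<Gamma>s))"
    by (intro shuffle_hom Sf_mset assms)
  moreover have "split C (map (ctx_objs C gi) \<Gamma>s) \<in> hom C (ctx_obj C gi (concat \<Gamma>s))
      (tens_objs C (map (ctx_obj C gi) \<Gamma>s))"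
    using split_hom[of "map (ctx_objs C gi) \<Gamma>s"] \<open>?ob ` set (concat \<Gamma>s) \<subseteq> Obj C\<close>
    by (auto simp: map_concat comp_def)
  ultimately show ?thesis
    unfolding ctx_split_def by (blast intro: Comp_hom)
qed

end

section \<open>Existence of interpretations\<close>

context autonomous_category
begin

lemma ty_obj_Obj: "gi ` set_ty A \<subseteq> Obj C \<Longrightarrow> ty_obj C gi A \<in> Obj C"
  by (induction A) (auto simp: image_Un unit_Obj tensor_Obj lolli_Obj)

text \<open>Evaluation is a chosen preimage of the identity under currying; surjectivity of currying
  places that preimage in the required hom-set.\<close>

lemma eval_arr_hom:
  assumes "X \<in> Obj C" "Y \<in> Obj C"
  shows "eval_arr C X Y \<in> hom C ((X \<multimap> Y) \<otimes> X) Y"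
proof -
  have "id_arr C (X \<multimap> Y) \<in> curry_arr C (X \<multimap> Y) X Y ` hom C ((X \<multimap> Y) \<otimes> X) Y"
    using bij_betw_imp_surj_on[OF curry_bij[OF assms lolli_Obj[OF assms]]] assms
    by (simp add: Id_hom lolli_Obj)
  then show ?thesis
    unfolding eval_arr_def by (rule inv_into_into)
qed

lemma curry_arr_hom:
  "X \<in> Obj C \<Longrightarrow> Z \<in> Obj C \<Longrightarrow> f \<in> hom C (Z \<otimes> X) Y \<Longrightarrow> curry_arr C Z X Y f \<in> hom C Z (X \<multimap> Y)"
  using curry_bij[of X Y Z] hom_Cod_Obj[of f] by (auto dest: bij_betwE)

lemma wf_ctx_Obj: "gi ` grounds S \<subseteq> Obj C \<Longrightarrow> wf_ctx S E \<Longrightarrow> set (ctx_objs C gi E) \<subseteq> Obj C"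
  by (force simp: wf_ctx_def wf_ty_def intro!: ty_obj_Obj)

text \<open>Induction on the typing derivation: each case composes the arrow prescribed by the
  matching rule of \<open>interp\<close>. Its domain and codomain are tracked along the way, as
  later compositions and the final embedding into a hom-set rely on them.\<close>

lemma interp_exists:
  assumes "typing S \<Gamma> v A"
    and S: "wf_sig S" and gi: "gi ` grounds S \<subseteq> Obj C"
    and oi: "\<And>f. f \<in> ops S \<Longrightarrow> oi f \<in> hom C (tens_objs C (map (ty_obj C gi) (args S f))) (ty_obj C gi (res S f))"
  shows "\<exists>m\<in>hom C (ctx_obj C gi \<Gamma>) (ty_obj C gi A). interp S C gi oi \<Gamma> v A m"
  using assms(1)
proof (induction rule: typing.induct)
  case (ty_Var x A)
  then have "ty_obj C gi A \<in> Obj C"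
    using wf_ctx_Obj[OF gi ty_Var] by simp
  with ty_Var show ?case
    using in_Var[OF ty_Var, of C gi oi] Id_hom[of "ty_obj C gi A"] by auto
next
  case (ty_Op f \<Gamma>s vs E)
  let ?n = "length (args S f)"
  \<comment> \<open>The bound on \<open>i\<close> is placed under the existential so that
    \<open>choice\<close> yields a function on all indices, which is then listed as
    \<open>?ms\<close>.\<close>
  have "\<forall>i. \<exists>m. i < ?n \<longrightarrow> m \<in> hom C (ctx_obj C gi (\<Gamma>s ! i)) (ty_obj C gi (args S f ! i)) \<and>
      interp S C gi oi (\<Gamma>s ! i) (vs ! i) (args S f ! i) m"
    using ty_Op.IH by blast
  from choice[OF this] obtain m where m: "\<And>i. i < ?n \<Longrightarrow>
      m i \<in> hom C (ctx_obj C gi (\<Gamma>s ! i)) (ty_obj C gi (args S f ! i))"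
      "\<And>i. i < ?n \<Longrightarrow> interp S C gi oi (\<Gamma>s ! i) (vs ! i) (args S f ! i) (m i)"
    by blast
  let ?ms = "map m [0..<?n]"
  have "tens_arrs C ?ms \<in> hom C (tens_objs C (map (ctx_obj C gi) \<Gamma>s))
      (tens_objs C (map (ty_obj C gi) (args S f)))"
    using m ty_Op.hyps by (intro tens_arrs_hom) auto
  then have "oi f \<cdot> tens_arrs C ?ms \<cdot> ctx_split C gi \<Gamma>s E \<in> hom C (ctx_obj C gi E) (ty_obj C gi (res S f))"
    using oi[OF ty_Op.hyps(1)] ctx_split_hom[OF ty_Op.hyps(4) wf_ctx_Obj[OF gi ty_Op.hyps(5)]]
    by - (assumption | rule Comp_hom)+
  moreover have "interp S C gi oi E (Op f vs) (res S f) (oi f \<cdot> tens_arrs C ?ms \<cdot> ctx_split C gi \<Gamma>s E)"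
    using ty_Op.hyps m by (intro in_Op) auto
  ultimately show ?case by blast
next
  case ty_Star
  then show ?case
    using in_Star[of S C gi oi] Id_hom[OF unit_Obj] by auto
next
  case (ty_LetStar \<Gamma> v \<Delta> w A E)
  from ty_LetStar.IH obtain m n where m: "m \<in> hom C (ctx_obj C gi \<Gamma>) (ty_obj C gi Unit)"
      "interp S C gi oi \<Gamma> v Unit m"
      and n: "n \<in> hom C (ctx_obj C gi \<Delta>) (ty_obj C gi A)" "interp S C gi oi \<Delta> w A n"
    by (elim bexE) (rule that)
  have \<Delta>: "ctx_obj C gi \<Delta> \<in> Obj C"
    using n hom_Dom_Obj by blast
  have "ctx_split C gi [\<Gamma>, \<Delta>] E \<in> hom C (ctx_obj C gi E) (ctx_obj C gi \<Gamma> \<otimes> ctx_obj C gi \<Delta>)"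
    using ctx_split_hom[OF ty_LetStar.hyps(3) wf_ctx_Obj[OF gi]] ty_LetStar.hyps by simp
  then have "n \<cdot> lunit C (ctx_obj C gi \<Delta>) \<cdot> (m \<boxtimes> id_arr C (ctx_obj C gi \<Delta>)) \<cdot> ctx_split C gi [\<Gamma>, \<Delta>] E
      \<in> hom C (ctx_obj C gi E) (ty_obj C gi A)"
    using tensor_hom[OF m(1)[simplified] Id_hom[OF \<Delta>]] iso_arrs_hom[OF lunit_iso[OF \<Delta>]] n(1)
    by - (assumption | rule Comp_hom)+
  \<comment> \<open>After rotation the first premise of \<open>bexI\<close> is the membership, so
    the chained fact supplies the witness.\<close>
  then show ?case
    by (rule bexI[rotated]) (rule in_LetStar[OF m(2) n(2) ty_LetStar.hyps(3,4)])
next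
  case (ty_Tens \<Gamma> v A \<Delta> w B E)
  from ty_Tens.IH obtain m n where m: "m \<in> hom C (ctx_obj C gi \<Gamma>) (ty_obj C gi A)" "interp S C gi oi \<Gamma> v A m"
      and n: "n \<in> hom C (ctx_obj C gi \<Delta>) (ty_obj C gi B)" "interp S C gi oi \<Delta> w B n"
    by (elim bexE) (rule that)
  have "ctx_split C gi [\<Gamma>, \<Delta>] E \<in> hom C (ctx_obj C gi E) (ctx_obj C gi \<Gamma> \<otimes> ctx_obj C gi \<Delta>)"
    using ctx_split_hom[OF ty_Tens.hyps(3) wf_ctx_Obj[OF gi]] ty_Tens.hyps by simp
  then have "(m \<boxtimes> n) \<cdot> ctx_split C gi [\<Gamma>, \<Delta>] E \<in> hom C (ctx_obj C gi E) (ty_obj C gi (Tensor A B))"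
    using tensor_hom[OF m(1) n(1)] Comp_hom by simp
  then show ?case
    by (rule bexI[rotated]) (rule in_Tens[OF m(2) n(2) ty_Tens.hyps(3,4)])
next
  case (ty_PM \<Gamma> v A B \<Delta> x y w D E)
  from ty_PM.IH obtain m n where m: "m \<in> hom C (ctx_obj C gi \<Gamma>) (ty_obj C gi (Tensor A B))"
      "interp S C gi oi \<Gamma> v (Tensor A B) m"
      and n: "n \<in> hom C (ctx_obj C gi (\<Delta> @ [(x, A), (y, B)])) (ty_obj C gi D)"
      "interp S C gi oi (\<Delta> @ [(x, A), (y, B)]) w D n"
    by (elim bexE) (rule that)
  let ?\<Delta> = "ctx_obj C gi \<Delta>" and ?A = "ty_obj C gi A" and ?B = "ty_obj C gi B"
  have Obj: "set (ctx_objs C gi \<Delta>) \<subseteq> Obj C" "?A \<in> Obj C" "?B \<in> Obj C"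
    using wf_ctx_Obj[OF gi typing_wf_ctx[OF ty_PM.hyps(2)]] by auto
  have \<Delta>: "?\<Delta> \<in> Obj C"
    using Obj by (intro tens_objs_Obj)
  have "ctx_split C gi [\<Gamma>, \<Delta>] E \<in> hom C (ctx_obj C gi E) (ctx_obj C gi \<Gamma> \<otimes> ?\<Delta>)"
    using ctx_split_hom[OF ty_PM.hyps(3) wf_ctx_Obj[OF gi]] ty_PM.hyps by simp
  moreover have "m \<boxtimes> id_arr C ?\<Delta> \<in> hom C (ctx_obj C gi \<Gamma> \<otimes> ?\<Delta>) (ty_obj C gi (Tensor A B) \<otimes> ?\<Delta>)"
    using m \<Delta> by (intro tensor_hom Id_hom)
  \<comment> \<open>The split puts the pair to the left of \<open>\<Delta>\<close>, whereas
    \<open>w\<close> expects its components after \<open>\<Delta>\<close>; the braiding exchanges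
    them before reassociation.\<close>
  moreover have "braid C (ty_obj C gi (Tensor A B)) ?\<Delta> \<in>
      hom C (ty_obj C gi (Tensor A B) \<otimes> ?\<Delta>) (?\<Delta> \<otimes> (?A \<otimes> ?B))"
    using iso_arrs_hom[OF braid_iso[OF tensor_Obj[OF Obj(2,3)] \<Delta>]] by simp
  moreover have "inv_arr C (assoc C ?\<Delta> ?A ?B) \<in> hom C (?\<Delta> \<otimes> (?A \<otimes> ?B)) ((?\<Delta> \<otimes> ?A) \<otimes> ?B)"
    using Obj \<Delta> by (intro iso_arrs_hom inv_arr_iso assoc_iso)
  moreover have "join C [ctx_objs C gi \<Delta>, [?A], [?B]] \<in>
      hom C ((?\<Delta> \<otimes> ?A) \<otimes> ?B) (ctx_obj C gi (\<Delta> @ [(x, A), (y, B)]))"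
    using join_hom[of "[ctx_objs C gi \<Delta>, [?A], [?B]]"] Obj by auto
  ultimately have "n \<cdot> join C [ctx_objs C gi \<Delta>, [?A], [?B]] \<cdot> inv_arr C (assoc C ?\<Delta> ?A ?B)
      \<cdot> braid C (ty_obj C gi (Tensor A B)) ?\<Delta> \<cdot> (m \<boxtimes> id_arr C ?\<Delta>) \<cdot> ctx_split C gi [\<Gamma>, \<Delta>] E
      \<in> hom C (ctx_obj C gi E) (ty_obj C gi D)"
    using n(1) by - (assumption | rule Comp_hom)+
  then show ?case
    by (rule bexI[rotated]) (rule in_PM[OF m(2) n(2) ty_PM.hyps(3,4)])
next
  case (ty_LAM \<Gamma> x A v B)
  from ty_LAM.IH obtain m where m: "m \<in> hom C (ctx_obj C gi (\<Gamma> @ [(x, A)])) (ty_obj C gi B)"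
      "interp S C gi oi (\<Gamma> @ [(x, A)]) v B m"
    by (elim bexE) (rule that)
  let ?\<Gamma> = "ctx_obj C gi \<Gamma>" and ?A = "ty_obj C gi A"
  have Obj: "set (ctx_objs C gi \<Gamma>) \<subseteq> Obj C" "?A \<in> Obj C"
    using wf_ctx_Obj[OF gi typing_wf_ctx[OF ty_LAM.hyps(1)]] by auto
  have "join C [ctx_objs C gi \<Gamma>, [?A]] \<in> hom C (?\<Gamma> \<otimes> ?A) (ctx_obj C gi (\<Gamma> @ [(x, A)]))"
    using join_hom[of "[ctx_objs C gi \<Gamma>, [?A]]"] Obj by auto
  then have "curry_arr C ?\<Gamma> ?A (ty_obj C gi B) (m \<cdot> join C [ctx_objs C gi \<Gamma>, [?A]]) \<in>
      hom C ?\<Gamma> (ty_obj C gi (Lolli A B))"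
    using m Obj by (auto intro!: curry_arr_hom tens_objs_Obj Comp_hom)
  then show ?case
    by (rule bexI[rotated]) (rule in_LAM[OF m(2)])
next
  case (ty_App \<Gamma> v A B \<Delta> w E)
  from ty_App.IH obtain m n where m: "m \<in> hom C (ctx_obj C gi \<Gamma>) (ty_obj C gi (Lolli A B))"
      "interp S C gi oi \<Gamma> v (Lolli A B) m"
      and n: "n \<in> hom C (ctx_obj C gi \<Delta>) (ty_obj C gi A)" "interp S C gi oi \<Delta> w A n"
    by (elim bexE) (rule that)
  \<comment> \<open>That \<open>A \<multimap> B\<close> denotes an object does not make
    \<open>B\<close> denote one, and \<open>B\<close> need not occur in a context. Well-formedness
    of the function type gives both components.\<close>
  have "wf_ty S (Lolli A B)"
    using ty_App.hyps(1) S by (rule typing_wf_ty)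
  then have Obj: "ty_obj C gi A \<in> Obj C" "ty_obj C gi B \<in> Obj C"
    using gi by (auto simp: wf_ty_def intro!: ty_obj_Obj)
  have "ctx_split C gi [\<Gamma>, \<Delta>] E \<in> hom C (ctx_obj C gi E) (ctx_obj C gi \<Gamma> \<otimes> ctx_obj C gi \<Delta>)"
    using ctx_split_hom[OF ty_App.hyps(3) wf_ctx_Obj[OF gi]] ty_App.hyps by simp
  moreover have "m \<boxtimes> n \<in> hom C (ctx_obj C gi \<Gamma> \<otimes> ctx_obj C gi \<Delta>)
      ((ty_obj C gi A \<multimap> ty_obj C gi B) \<otimes> ty_obj C gi A)"
    using tensor_hom[OF m(1) n(1)] by simp
  ultimately have "eval_arr C (ty_obj C gi A) (ty_obj C gi B) \<cdot> (m \<boxtimes> n) \<cdot> ctx_split C gi [\<Gamma>, \<Delta>] E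
      \<in> hom C (ctx_obj C gi E) (ty_obj C gi B)"
    using eval_arr_hom[OF Obj] by - (assumption | rule Comp_hom)+
  then show ?case
    by (rule bexI[rotated]) (rule in_App[OF m(2) n(2) ty_App.hyps(3,4)])
qed

end

section \<open>The internal language\<close>

lemma Lang_simps [simp]:
  "grounds (Lang B C) = grounds (lang_sig C)" "ops (Lang B C) = ops (lang_sig C)"
  "args (Lang B C) = args (lang_sig C)" "res (Lang B C) = res (lang_sig C)"
  "axioms (Lang B C) = {(\<Gamma>, v, q, w, A). q \<in> B \<and>
     satisfied (lang_sig C) C (\<lambda>X. X) (lang_op_arr C) (\<Gamma>, v, q, w, A)}"
  by (simp_all add: Lang_def sig.extend_def vtheory.fields_def lang_sig_def)

lemma typing_Lang: "typing (Lang B C) \<Gamma> v A \<longleftrightarrow> typing (lang_sig C) \<Gamma> v A"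
  by (auto elim: typing_cong)

lemma satisfied_iff: "satisfied S C gi oi (\<Gamma>, v, q, w, A) \<longleftrightarrow>
    (\<exists>m n. interp S C gi oi \<Gamma> v A m \<and> interp S C gi oi \<Gamma> w A n \<and> q \<le> dist C m n)"
  by (simp add: satisfied_def)

context autonomous_category
begin

lemma wf_sig_Lang: "wf_sig (lang_sig C)"
  using Dom_Obj Cod_Obj ty_obj_Obj[of "\<lambda>X. X"]
  by (auto simp: wf_sig_def wf_ty_def lang_sig_def)

text \<open>\<open>lang_i C\<close> sends the ground type \<open>Ground (lang_i C A)\<close> back to
  \<open>lang_i C A\<close>, so \<open>To A\<close> and \<open>From A\<close> have equal interpreted
  source and target and an identity fits both.\<close>

lemma lang_op_arr_hom:
  assumes "f \<in> ops (lang_sig C)"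
  shows "lang_op_arr C f \<in> hom C (tens_objs C (map (lang_i C) (args (lang_sig C) f)))
    (lang_i C (res (lang_sig C) f))"
  using assms Id_hom ty_obj_Obj[of "\<lambda>X. X"] by (auto simp: lang_sig_def hom_def)

lemma lang_interp_exists:
  assumes "typing (lang_sig C) \<Gamma> v A"
  shows "\<exists>m\<in>hom C (ctx_obj C (\<lambda>X. X) \<Gamma>) (lang_i C A).
    interp (lang_sig C) C (\<lambda>X. X) (lang_op_arr C) \<Gamma> v A m"
  using assms wf_sig_Lang lang_op_arr_hom
  by (intro interp_exists) (auto simp: lang_sig_def)

end

text \<open>Satisfaction of an equation includes interpretations of both sides, so
  \<open>interp_typing\<close> makes every axiom well typed.\<close>

lemma (in enriched_autonomous_category) linear_vtheory_Lang: "linear_vtheory B (Lang B C)"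
  using wf_sig_Lang
  by (auto simp: linear_vtheory_def wf_sig_def wf_ty_def typing_Lang satisfied_iff dest: interp_typing)

section \<open>Syntactic distances and the equivalence they induce\<close>

lemma one_le_iff: "(1 :: 'v::integral_quantale) \<le> x \<longleftrightarrow> x = 1"
  by (simp add: one_eq_top top_unique)

text \<open>\<open>mult_Sup\<close> distributes over joins on the right; commutativity gives the
  left side.\<close>

lemma Sup_mult_Sup_le:
  fixes P :: "'v::integral_quantale set"
  assumes "\<And>p q. p \<in> P \<Longrightarrow> q \<in> Q \<Longrightarrow> p * q \<le> z"
  shows "Sup P * Sup Q \<le> z"
proof -
  have "Sup P * q \<le> z" if "q \<in> Q" for q
    using that assms by (subst mult.commute) (auto simp: mult_Sup mult.commute[of q] intro!: Sup_least)
  then show ?thesis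
    by (auto simp: mult_Sup[of "Sup P"] intro!: Sup_least)
qed

context continuous_quantale_basis
begin

lemma syn_dist_refl: "v \<in> terms_in T x A A' \<Longrightarrow> 1 \<le> syn_dist B T x A A' v v"
  using one_closed provable.refl[of T "[(x, A)]" v A' B]
  by (auto simp: syn_dist_def terms_in_def one_eq_top intro!: Sup_upper)

text \<open>The product of two provable labels stays in \<open>B\<close> and is provable by
  transitivity; such products are bounded one by one.\<close>

lemma syn_dist_trans: "syn_dist B T x A A' u v * syn_dist B T x A A' v w \<le> syn_dist B T x A A' u w"
  unfolding syn_dist_def
  by (rule Sup_mult_Sup_le) (auto intro!: Sup_upper mult_closed intro: provable.trans)

text \<open>Symmetry is built in. For transitivity, integrality turns \<open>1 \<le> d\<close> into
  \<open>d = 1\<close>, and \<open>syn_dist_trans\<close> is used with 1 * 1 = 1. This justifies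
  reasoning about \<open>syn_hom\<close> through classes.\<close>

lemma equiv_syn_dist:
  "equiv (terms_in T x A A') {(v, w). v \<in> terms_in T x A A' \<and> w \<in> terms_in T x A A' \<and>
     1 \<le> syn_dist B T x A A' v w \<and> 1 \<le> syn_dist B T x A A' w v}"
proof (rule equivI)
  have "1 \<le> syn_dist B T x A A' u w"
    if "1 \<le> syn_dist B T x A A' u v" "1 \<le> syn_dist B T x A A' v w" for u v w
    using that syn_dist_trans[of T x A A' u v w] by (simp add: one_le_iff)
  then show "Relation.trans {(v, w). v \<in> terms_in T x A A' \<and> w \<in> terms_in T x A A' \<and>
     1 \<le> syn_dist B T x A A' v w \<and> 1 \<le> syn_dist B T x A A' w v}"
    by (intro transI) blast
qed (auto simp: refl_on_def sym_def syn_dist_refl)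

end

section \<open>Embedding the syntactic hom into a hom-set\<close>

lemma small_inj_on:
  assumes "inj_on f X" "f ` X \<subseteq> Y" "small \<kappa> Y"
  shows "small \<kappa> X"
  using assms card_of_ordLeq ordLeq_ordLess_trans unfolding small_def by metis

lemma varietal_Lang:
  fixes B :: "'v::integral_quantale set" and C :: "('o, 'm, 'v) autcat"
  assumes "continuous_quantale_basis B" and "enriched_autonomous_category C \<kappa>"
  shows "varietal \<kappa> B (Lang B C)"
  unfolding varietal_def
proof (intro allI impI)
  interpret continuous_quantale_basis B by fact
  interpret enriched_autonomous_category C \<kappa> by fact
  fix x A A'
  assume wf: "wf_ty (Lang B C) A" "wf_ty (Lang B C) A'"
  then have Obj: "lang_i C A \<in> Obj C" "lang_i C A' \<in> Obj C"
    by (auto simp: wf_ty_def lang_sig_def intro!: ty_obj_Obj)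
  let ?I = "interp (lang_sig C) C (\<lambda>X. X) (lang_op_arr C) [(x, A)]"
  let ?H = "hom C (lang_i C A) (lang_i C A')"
  let ?t = "terms_in (Lang B C) x A A'"
  define R where "R = {(v, w). v \<in> ?t \<and> w \<in> ?t \<and>
      1 \<le> syn_dist B (Lang B C) x A A' v w \<and> 1 \<le> syn_dist B (Lang B C) x A A' w v}"
  have equiv: "equiv ?t R"
    unfolding R_def by (rule equiv_syn_dist)
  have common: "(v, w) \<in> R"
    if "v \<in> ?t" "w \<in> ?t" "m \<in> ?H" "?I v A' m" "?I w A' m" for v w m
  proof -
    have "1 \<le> dist C m m"
      using hom_vcat[OF Obj] \<open>m \<in> ?H\<close> by (simp add: vcat_def)
    then have "satisfied (lang_sig C) C (\<lambda>X. X) (lang_op_arr C) ([(x, A)], v, 1, w, A')"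
      "satisfied (lang_sig C) C (\<lambda>X. X) (lang_op_arr C) ([(x, A)], w, 1, v, A')"
      unfolding satisfied_iff using that by blast+
    \<comment> \<open>The label 1 lies in the basis, so both satisfied equations are axioms; each
      then contributes 1 to the join defining its distance.\<close>
    then have "provable B (Lang B C) [(x, A)] v 1 w A'" "provable B (Lang B C) [(x, A)] w 1 v A'"
      using one_closed by (simp_all add: provable.axiom)
    then show ?thesis
      using that one_closed by (auto simp: R_def syn_dist_def intro!: Sup_upper)
  qed
  have "\<exists>m v. v \<in> K \<and> v \<in> ?t \<and> m \<in> ?H \<and> ?I v A' m" if "K \<in> ?t // R" for K
  proof -
    obtain v where "v \<in> ?t" "K = R `` {v}"
      using \<open>K \<in> ?t // R\<close> by (rule quotientE)
    \<comment> \<open>The tensor of the one-entry context is \<open>lang_i C A\<close> itself, so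
      the interpretation given by \<open>lang_interp_exists\<close> lies in
      \<open>?H\<close>.\<close>
    then show ?thesis
      using equiv_class_self[OF equiv] lang_interp_exists[of "[(x, A)]" v A']
      by (auto simp: terms_in_def typing_Lang)
  qed
  \<comment> \<open>Arrow and representative are paired so that one use of \<open>choice\<close>
    selects them together, the arrow interpreting that representative.\<close>
  then have "\<forall>K. \<exists>p. K \<in> ?t // R \<longrightarrow> snd p \<in> K \<and> snd p \<in> ?t \<and> fst p \<in> ?H \<and> ?I (snd p) A' (fst p)"
    by (metis fst_conv snd_conv)
  from choice[OF this] obtain p where p: "\<And>K. K \<in> ?t // R \<Longrightarrow>
      snd (p K) \<in> K \<and> snd (p K) \<in> ?t \<and> fst (p K) \<in> ?H \<and> ?I (snd (p K)) A' (fst (p K))"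
    by blast
  define F v where "F = fst \<circ> p" and "v = snd \<circ> p"
  have F: "v K \<in> K" "v K \<in> ?t" "F K \<in> ?H" "?I (v K) A' (F K)" if "K \<in> ?t // R" for K
    using p[OF that] by (simp_all add: F_def v_def)
  have "inj_on F (?t // R)"
  proof (rule inj_onI)
    fix K L
    assume KL: "K \<in> ?t // R" "L \<in> ?t // R" "F K = F L"
    \<comment> \<open>The arrow \<open>F K = F L\<close> interprets both representatives, so
      \<open>common\<close> relates them and their classes coincide.\<close>
    then have "(v K, v L) \<in> R"
      using common[OF F(2)[OF KL(1)] F(2)[OF KL(2)] F(3,4)[OF KL(1)]] F(4)[OF KL(2)] by simp
    then show "K = L"
      by (rule quotient_eqI[OF equiv KL(1,2) F(1)[OF KL(1)] F(1)[OF KL(2)]])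
  qed
  moreover have "F ` (?t // R) \<subseteq> ?H"
    using F by blast
  ultimately have "small \<kappa> (?t // R)"
    using hom_small[OF Obj] by (rule small_inj_on)
  then show "small \<kappa> (syn_hom B (Lang B C) x A A')"
    by (simp add: syn_hom_def R_def)
qed

theorem theorem3p17:
  fixes B :: "'v::integral_quantale set" and C :: "('o, 'm, 'v) autcat" and \<kappa> :: "'k rel"
  assumes "continuous_quantale_basis B"
    and "Card_order \<kappa>"
    and "enriched_autonomous_category C \<kappa>"
  shows "linear_vtheory B (Lang B C) \<and> varietal \<kappa> B (Lang B C)"
proof -
  interpret enriched_autonomous_category C \<kappa> by fact
  show ?thesis
    using linear_vtheory_Lang varietal_Lang assms(1,3) by blast
qed

end
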